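(* Suppose $n$ is an even integer with $t_3\leq n<\min\{t_1,t_2\}$, and put $K=k_1+k_2+k_3$. Then: (i) the $\mathfrak{BI}$-module $\mathscr M_n(x_3)$ is isomorphic to $W_1\oplus W_1$, where $W_1=E_{n-t_3}\big(k_1+\tfrac{n+1}{2},\,-K-\tfrac{n+1}{2},\,-k_2-\tfrac{n+1}{2}\big)^{((-1,1),(1\,3\,2))}$; (ii) the $\mathfrak{BI}$-module $\mathscr M_n/\mathscr M_n(x_3)$ is isomorphic to $W_2\oplus W_2$, where $W_2=O_{t_3-1}(k_1,\,-K-n-1,\,-k_2)^{((1,-1),(1\,3\,2))}$. Moreover, if $k_1,k_2\geq0$, then $W_1,W_2$ are irreducible and isomorphic to $E_{n-t_3}\big(k_2+\tfrac{n+1}{2},\,k_1+\tfrac{n+1}{2},\,K+\tfrac{n+1}{2}\big)^{(-1,-1)}$ and $O_{t_3-1}(k_2,\,k_1,\,K+n+1)$, respectively.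
   Context: Fix real numbers $k_1,k_2,k_3$. For $i=1,2,3$ let $R_i$ be the operator on functions on $\mathbb R^3$ replacing $x_i$ by $-x_i$, and $T_if=\frac{\partial f}{\partial x_i}+k_i\frac{f-R_if}{x_i}$ (Dunkl operators). Let $\sigma_1=\begin{pmatrix}0&1\\1&0\end{pmatrix}$, $\sigma_2=\begin{pmatrix}0&-\sqrt{-1}\\ \sqrt{-1}&0\end{pmatrix}$, $\sigma_3=\begin{pmatrix}1&0\\0&-1\end{pmatrix}$, and let $e_i$ act on $\mathbb C^2$ by $\sigma_i$. Tensor products are over $\mathbb R$; $\mathbb R[\cdots]_m$ denotes homogeneous polynomials of degree $m$. Let $\mathbf D=e_1\otimes T_1+e_2\otimes T_2+e_3\otimes T_3$ and $\mathscr M_n=\ker(\mathbf D|_{\mathbb C^2\otimes\mathbb R[x_1,x_2,x_3]_n})$. For $i=1,2,3$ set $t_i=-2k_i$ if $2k_i$ is an odd negative integer, and $t_i=\infty$ otherwise. For $i=1,2,3$, $\mathscr M_n(x_i)=\mathscr M_n\cap\bigoplus_{j=t_i}^n\mathbb C^2\otimes(x_i^j\cdot\mathbb R[x_p,x_q]_{n-j})$ where $\{p,q\}=\{1,2,3\}\setminus\{i\}$ (it is $\{0\}$ if $n<t_i$); it is a $\mathfrak{BI}$-submodule of $\mathscr M_n$. $\mathfrak{BI}$ is the unital associative $\mathbb C$-algebra generated by $X,Y,Z$ with relations saying that $\{X,Y\}-Z$, $\{Y,Z\}-X$, $\{Z,X\}-Y$ commute with $X,Y,Z$ ($\{A,B\}=AB+BA$).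 $\mathscr M_n$ is a $\mathfrak{BI}$-module via $X=(\sqrt{-1}\,e_1\otimes(x_3T_2-x_2T_3)+\tfrac12)R_2R_3+k_2R_3+k_3R_2$, $Y=(\sqrt{-1}\,e_2\otimes(x_1T_3-x_3T_1)+\tfrac12)R_1R_3+k_3R_1+k_1R_3$, $Z=(\sqrt{-1}\,e_3\otimes(x_2T_1-x_1T_2)+\tfrac12)R_1R_2+k_1R_2+k_2R_1$, operators composed right to left, $R_i$ acting on the polynomial factor. Twisting: for a $\mathfrak{BI}$-module $V$ and algebra automorphism $\varepsilon$, $V^\varepsilon$ is $V$ with action $x\cdot v=\varepsilon(x)v$. Write $(W_1,W_2,W_3)=(X,Y,Z)$. A permutation $\sigma\in\mathfrak S_3$ denotes the automorphism $W_i\mapsto W_{\sigma(i)}$; the sign automorphisms are $(1,-1)\colon X\mapsto X,Y\mapsto -Y,Z\mapsto -Z$; $(-1,1)\colon X\mapsto -X,Y\mapsto Y,Z\mapsto -Z$; $(-1,-1)\colon X\mapsto -X,Y\mapsto -Y,Z\mapsto Z$; a pair $(\epsilon,\sigma)$ denotes the composite $\epsilon\circ\sigma$. For $a,b,c\in\mathbb C$ and an integer $d\geq0$, let $\theta_i=\frac{(-1)^i(2a-d+2i)}{2}$, $\theta^*_i=\frac{(-1)^i(2b-d+2i)}{2}$ ($0\le i\le d$). For odd $d$, $E_d(a,b,c)$ is the $\mathfrak{BI}$-module $\mathbb C^{d+1}$ in which, w.r.t. a basis $v_0,\dots,v_d$, $X$ acts by the lower bidiagonal matrix with diagonal $(\theta_i)$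 and subdiagonal entries $1$, $Y$ by the upper bidiagonal matrix with diagonal $(\theta^*_i)$ and superdiagonal $(\varphi_1,\dots,\varphi_d)$ with $\varphi_i=i(d-i+1)$ ($i$ even), $\varphi_i=c^2-\frac{(2a+2b-d+2i-1)^2}{4}$ ($i$ odd), and $Z=\{X,Y\}-\big(c^2-a^2-b^2+\frac{(d+1)^2}{4}\big)$. For even $d$, $O_d(a,b,c)$ is defined in the same way but with $\varphi_i=\frac{i(d+1-2i-2a-2b-2c)}{2}$ ($i$ even), $\varphi_i=\frac{(i-d-1)(d+1-2i-2a-2b+2c)}{2}$ ($i$ odd), and $Z=\{X,Y\}-(2ab-c(d+1))$. *)

theory Defs
  imports Complex_Main "HOL-Library.Extended_Nat"
begin

text \<open>Vectors are complex-valued functions on an index type. A BI-module is given by a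
carrier (a complex subspace) and the three operators by which the generators X, Y, Z act.\<close>

record 'i bimod =
  bm_carrier :: "('i \<Rightarrow> complex) set"
  bm_X :: "('i \<Rightarrow> complex) \<Rightarrow> ('i \<Rightarrow> complex)"
  bm_Y :: "('i \<Rightarrow> complex) \<Rightarrow> ('i \<Rightarrow> complex)"
  bm_Z :: "('i \<Rightarrow> complex) \<Rightarrow> ('i \<Rightarrow> complex)"

definition vadd :: "('i \<Rightarrow> complex) \<Rightarrow> ('i \<Rightarrow> complex) \<Rightarrow> ('i \<Rightarrow> complex)" where
  "vadd u v = (\<lambda>x. u x + v x)"

definition vsub :: "('i \<Rightarrow> complex) \<Rightarrow> ('i \<Rightarrow> complex) \<Rightarrow> ('i \<Rightarrow> complex)" where
  "vsub u v = (\<lambda>x. u x - v x)"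

definition vsc :: "complex \<Rightarrow> ('i \<Rightarrow> complex) \<Rightarrow> ('i \<Rightarrow> complex)" where
  "vsc c v = (\<lambda>x. c * v x)"

definition vzero :: "'i \<Rightarrow> complex" where
  "vzero = (\<lambda>x. 0)"

definition bm_gen :: "'i bimod \<Rightarrow> nat \<Rightarrow> ('i \<Rightarrow> complex) \<Rightarrow> ('i \<Rightarrow> complex)" where
  "bm_gen M i = (if i = 1 then bm_X M else if i = 2 then bm_Y M else bm_Z M)"

definition complex_linear_on :: "('i \<Rightarrow> complex) set \<Rightarrow> (('i \<Rightarrow> complex) \<Rightarrow> ('j \<Rightarrow> complex)) \<Rightarrow> bool" where
  "complex_linear_on V f \<longleftrightarrow>
     (\<forall>u\<in>V. \<forall>v\<in>V. f (vadd u v) = vadd (f u) (f v)) \<and> (\<forall>c. \<forall>v\<in>V. f (vsc c v) = vsc c (f v))"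

definition intertwines :: "'i bimod \<Rightarrow> 'j bimod \<Rightarrow> (('i \<Rightarrow> complex) \<Rightarrow> ('j \<Rightarrow> complex)) \<Rightarrow> bool" where
  "intertwines M N f \<longleftrightarrow>
     (\<forall>v\<in>bm_carrier M. f (bm_X M v) = bm_X N (f v) \<and> f (bm_Y M v) = bm_Y N (f v)
                          \<and> f (bm_Z M v) = bm_Z N (f v))"

definition bimod_iso :: "'i bimod \<Rightarrow> 'j bimod \<Rightarrow> bool" where
  "bimod_iso M N \<longleftrightarrow> (\<exists>f. complex_linear_on (bm_carrier M) f \<and> bij_betw f (bm_carrier M) (bm_carrier N)
                              \<and> intertwines M N f)"

text \<open>\<open>M / S \<cong> N\<close> (S a submodule of M): by the first isomorphism theorem, this holds iff there is a
surjective module homomorphism \<open>M \<rightarrow> N\<close> with kernel exactly S.\<close>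
definition bimod_quot_iso :: "'i bimod \<Rightarrow> ('i \<Rightarrow> complex) set \<Rightarrow> 'j bimod \<Rightarrow> bool" where
  "bimod_quot_iso M S N \<longleftrightarrow> (\<exists>f. complex_linear_on (bm_carrier M) f \<and> f ` bm_carrier M = bm_carrier N
        \<and> (\<forall>v\<in>bm_carrier M. f v = vzero \<longleftrightarrow> v \<in> S) \<and> intertwines M N f)"

definition is_submodule :: "'i bimod \<Rightarrow> ('i \<Rightarrow> complex) set \<Rightarrow> bool" where
  "is_submodule M U \<longleftrightarrow> U \<subseteq> bm_carrier M \<and> vzero \<in> U \<and> (\<forall>u\<in>U. \<forall>v\<in>U. vadd u v \<in> U)
     \<and> (\<forall>c. \<forall>u\<in>U. vsc c u \<in> U)
     \<and> (\<forall>u\<in>U. bm_X M u \<in> U \<and> bm_Y M u \<in> U \<and> bm_Z M u \<in> U)"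

definition bimod_irreducible :: "'i bimod \<Rightarrow> bool" where
  "bimod_irreducible M \<longleftrightarrow> bm_carrier M \<noteq> {vzero} \<and>
     (\<forall>U. is_submodule M U \<longrightarrow> U = {vzero} \<or> U = bm_carrier M)"

definition bm_restrict :: "'i bimod \<Rightarrow> ('i \<Rightarrow> complex) set \<Rightarrow> 'i bimod" where
  "bm_restrict M U = M\<lparr>bm_carrier := U\<rparr>"

definition bm_dsum :: "'i bimod \<Rightarrow> 'j bimod \<Rightarrow> ('i + 'j) bimod" where
  "bm_dsum M N =
    (let l = (\<lambda>v. \<lambda>i. v (Inl i)); r = (\<lambda>v. \<lambda>j. v (Inr j));
         comb = (\<lambda>A B v. \<lambda>x. case x of Inl i \<Rightarrow> A (l v) i | Inr j \<Rightarrow> B (r v) j)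
     in \<lparr> bm_carrier = {v. l v \<in> bm_carrier M \<and> r v \<in> bm_carrier N},
          bm_X = comb (bm_X M) (bm_X N), bm_Y = comb (bm_Y M) (bm_Y N),
          bm_Z = comb (bm_Z M) (bm_Z N) \<rparr>)"

text \<open>Twisting by the automorphism \<open>(\<epsilon>, \<sigma>) = \<epsilon> \<circ> \<sigma>\<close>, where \<open>\<sigma>\<close> maps \<open>W_i \<mapsto> W_{\<sigma> i}\<close> and
the sign automorphism \<open>\<epsilon> = (e1, e2)\<close> maps \<open>X \<mapsto> e1 X, Y \<mapsto> e2 Y, Z \<mapsto> e1 e2 Z\<close>
(so \<open>(1,-1), (-1,1), (-1,-1)\<close> are exactly the three sign automorphisms of the paper, and
\<open>(1,1)\<close> is the identity). In \<open>V^{\<epsilon>\<circ>\<sigma>}\<close>, \<open>W_i\<close> acts as \<open>\<epsilon>(W_{\<sigma> i})\<close>.\<close>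
definition sign_of :: "int \<times> int \<Rightarrow> nat \<Rightarrow> complex" where
  "sign_of e j = (if j = 1 then of_int (fst e) else if j = 2 then of_int (snd e)
                  else of_int (fst e * snd e))"

definition bm_twist :: "int \<times> int \<Rightarrow> (nat \<Rightarrow> nat) \<Rightarrow> 'i bimod \<Rightarrow> 'i bimod" where
  "bm_twist e \<sigma> M =
     (let act = (\<lambda>i v. vsc (sign_of e (\<sigma> i)) (bm_gen M (\<sigma> i) v))
      in \<lparr> bm_carrier = bm_carrier M, bm_X = act 1, bm_Y = act 2, bm_Z = act 3 \<rparr>)"

definition cyc132 :: "nat \<Rightarrow> nat" where
  "cyc132 i = (if i = 1 then 3 else if i = 3 then 2 else if i = 2 then 1 else i)"

text \<open>Coordinates w.r.t. the basis \<open>v_0,\<dots>,v_d\<close>; a vector is a function \<open>nat \<Rightarrow> complex\<close> vanishing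
beyond d. X is lower bidiagonal (\<open>X v_j = \<theta>_j v_j + v_{j+1}\<close>), Y upper bidiagonal
(\<open>Y v_j = \<theta>*_j v_j + \<phi>_j v_{j-1}\<close>).\<close>

definition bd_lower :: "nat \<Rightarrow> (nat \<Rightarrow> complex) \<Rightarrow> (nat \<Rightarrow> complex) \<Rightarrow> (nat \<Rightarrow> complex)" where
  "bd_lower d th v = (\<lambda>i. if i \<le> d then th i * v i + (if 1 \<le> i then v (i - 1) else 0) else 0)"

definition bd_upper :: "nat \<Rightarrow> (nat \<Rightarrow> complex) \<Rightarrow> (nat \<Rightarrow> complex) \<Rightarrow> (nat \<Rightarrow> complex) \<Rightarrow> (nat \<Rightarrow> complex)" where
  "bd_upper d th ph v = (\<lambda>i. if i \<le> d then th i * v i + (if i + 1 \<le> d then ph (i + 1) * v (i + 1) else 0) else 0)"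

definition tri_module :: "nat \<Rightarrow> (nat \<Rightarrow> complex) \<Rightarrow> (nat \<Rightarrow> complex) \<Rightarrow> (nat \<Rightarrow> complex) \<Rightarrow> complex \<Rightarrow> nat bimod" where
  "tri_module d th ths ph \<kappa> =
     \<lparr> bm_carrier = {v. \<forall>i>d. v i = 0},
       bm_X = bd_lower d th, bm_Y = bd_upper d ths ph,
       bm_Z = (\<lambda>v. \<lambda>i. bd_lower d th (bd_upper d ths ph v) i + bd_upper d ths ph (bd_lower d th v) i - \<kappa> * v i) \<rparr>"

definition theta_seq :: "complex \<Rightarrow> nat \<Rightarrow> nat \<Rightarrow> complex" where
  "theta_seq a d i = (-1) ^ i * (2 * a - of_nat d + 2 * of_nat i) / 2"

definition E_mod :: "nat \<Rightarrow> complex \<Rightarrow> complex \<Rightarrow> complex \<Rightarrow> nat bimod" where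
  "E_mod d a b c = tri_module d (theta_seq a d) (theta_seq b d)
     (\<lambda>i. if even i then of_nat (i * (d - i + 1))
          else c ^ 2 - (2 * a + 2 * b - of_nat d + 2 * of_nat i - 1) ^ 2 / 4)
     (c ^ 2 - a ^ 2 - b ^ 2 + (of_nat d + 1) ^ 2 / 4)"

definition O_mod :: "nat \<Rightarrow> complex \<Rightarrow> complex \<Rightarrow> complex \<Rightarrow> nat bimod" where
  "O_mod d a b c = tri_module d (theta_seq a d) (theta_seq b d)
     (\<lambda>i. if even i then of_nat i * (of_nat d + 1 - 2 * of_nat i - 2 * a - 2 * b - 2 * c) / 2
          else (of_nat i - of_nat d - 1) * (of_nat d + 1 - 2 * of_nat i - 2 * a - 2 * b + 2 * c) / 2)
     (2 * a * b - c * (of_nat d + 1))"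

text \<open>An element of \<open>\<complex>^2 \<otimes>\<^sub>\<real> \<real>[x_1,x_2,x_3]\<close> is represented by its coefficient function:
\<open>p (s, a, b, c)\<close> is the coefficient of \<open>u_s \<otimes> x_1^a x_2^b x_3^c\<close>, where \<open>u_0, u_1\<close> is the
standard basis of \<open>\<complex>^2\<close> (only \<open>s < 2\<close> is meaningful). The complex structure is the one
coming from the \<open>\<complex>^2\<close> factor.\<close>

type_synonym idx = "nat \<times> nat \<times> nat \<times> nat"
type_synonym cpoly = "idx \<Rightarrow> complex"

definition expo :: "nat \<Rightarrow> idx \<Rightarrow> nat" where
  "expo i x = (case x of (s, a, b, c) \<Rightarrow> if i = 1 then a else if i = 2 then b else c)"

definition setexp :: "nat \<Rightarrow> nat \<Rightarrow> idx \<Rightarrow> idx" where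
  "setexp i m x = (case x of (s, a, b, c) \<Rightarrow>
     if i = 1 then (s, m, b, c) else if i = 2 then (s, a, m, c) else (s, a, b, m))"

definition comp :: "idx \<Rightarrow> nat" where
  "comp x = fst x"

definition tdeg :: "idx \<Rightarrow> nat" where
  "tdeg x = expo 1 x + expo 2 x + expo 3 x"

definition mulx :: "nat \<Rightarrow> cpoly \<Rightarrow> cpoly" where
  "mulx i p = (\<lambda>x. if 1 \<le> expo i x then p (setexp i (expo i x - 1) x) else 0)"

text \<open>Exact division by \<open>x_i\<close> (applied only to polynomials divisible by \<open>x_i\<close>).\<close>
definition divx :: "nat \<Rightarrow> cpoly \<Rightarrow> cpoly" where
  "divx i p = (\<lambda>x. p (setexp i (expo i x + 1) x))"

definition pderiv_x :: "nat \<Rightarrow> cpoly \<Rightarrow> cpoly" where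
  "pderiv_x i p = (\<lambda>x. of_nat (expo i x + 1) * p (setexp i (expo i x + 1) x))"

definition refl_x :: "nat \<Rightarrow> cpoly \<Rightarrow> cpoly" where
  "refl_x i p = (\<lambda>x. (-1) ^ expo i x * p x)"

definition kf :: "real \<Rightarrow> real \<Rightarrow> real \<Rightarrow> nat \<Rightarrow> real" where
  "kf k1 k2 k3 i = (if i = 1 then k1 else if i = 2 then k2 else k3)"

definition dunkl :: "(nat \<Rightarrow> real) \<Rightarrow> nat \<Rightarrow> cpoly \<Rightarrow> cpoly" where
  "dunkl k i p = vadd (pderiv_x i p) (vsc (of_real (k i)) (divx i (vsub p (refl_x i p))))"

text \<open>Action of \<open>e_i\<close> by the Pauli matrix \<open>\<sigma>_i\<close> on the \<open>\<complex>^2\<close> factor.\<close>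
definition cliff :: "nat \<Rightarrow> cpoly \<Rightarrow> cpoly" where
  "cliff i p = (\<lambda>x. case x of (s, a, b, c) \<Rightarrow>
     if i = 1 then (if s = 0 then p (1, a, b, c) else if s = 1 then p (0, a, b, c) else 0)
     else if i = 2 then (if s = 0 then - \<i> * p (1, a, b, c) else if s = 1 then \<i> * p (0, a, b, c) else 0)
     else (if s = 0 then p (0, a, b, c) else if s = 1 then - p (1, a, b, c) else 0))"

definition dirac :: "(nat \<Rightarrow> real) \<Rightarrow> cpoly \<Rightarrow> cpoly" where
  "dirac k p = vadd (cliff 1 (dunkl k 1 p)) (vadd (cliff 2 (dunkl k 2 p)) (cliff 3 (dunkl k 3 p)))"

definition hom_space :: "nat \<Rightarrow> cpoly set" where
  "hom_space n = {p. \<forall>x. p x \<noteq> 0 \<longrightarrow> comp x < 2 \<and> tdeg x = n}"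

definition Mn :: "(nat \<Rightarrow> real) \<Rightarrow> nat \<Rightarrow> cpoly set" where
  "Mn k n = {p \<in> hom_space n. dirac k p = vzero}"

definition ang :: "(nat \<Rightarrow> real) \<Rightarrow> nat \<Rightarrow> nat \<Rightarrow> cpoly \<Rightarrow> cpoly" where
  "ang k j l p = vsub (mulx j (dunkl k l p)) (mulx l (dunkl k j p))"

definition gen_op :: "(nat \<Rightarrow> real) \<Rightarrow> nat \<Rightarrow> nat \<Rightarrow> nat \<Rightarrow> cpoly \<Rightarrow> cpoly" where
  "gen_op k i p q f =
     (let g = refl_x p (refl_x q f) in
      vadd (vadd (vsc \<i> (cliff i (ang k q p g))) (vsc (1/2) g))
           (vadd (vsc (of_real (k p)) (refl_x q f)) (vsc (of_real (k q)) (refl_x p f))))"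

definition M_module :: "(nat \<Rightarrow> real) \<Rightarrow> nat \<Rightarrow> idx bimod" where
  "M_module k n = \<lparr> bm_carrier = Mn k n,
      bm_X = gen_op k 1 2 3, bm_Y = gen_op k 2 3 1, bm_Z = gen_op k 3 1 2 \<rparr>"

definition tpar :: "(nat \<Rightarrow> real) \<Rightarrow> nat \<Rightarrow> enat" where
  "tpar k i = (if \<exists>m::nat. odd m \<and> 2 * k i = - real m
               then enat (THE m::nat. odd m \<and> 2 * k i = - real m) else \<infinity>)"

text \<open>\<open>\<M>_n(x_i) = \<M>_n \<inter> \<Oplus>_{j = t_i}^n \<complex>^2 \<otimes> x_i^j \<real>[x_p,x_q]_{n-j}\<close>.\<close>
definition Mn_x :: "(nat \<Rightarrow> real) \<Rightarrow> nat \<Rightarrow> nat \<Rightarrow> cpoly set" where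
  "Mn_x k n i = Mn k n \<inter> {p. \<forall>x. p x \<noteq> 0 \<longrightarrow> tpar k i \<le> enat (expo i x)}"

end

theory Submission
  imports Defs
begin

text \<open>
  Restricting \<open>f \<in> \<M>\<^sub>n\<close> to \<open>x\<^sub>1 = 0\<close> is injective, and every polynomial in \<open>x\<^sub>2, x\<^sub>3\<close> has a
  (Cauchy-Kovalevskaya) extension, because \<open>T\<^sub>1 x\<^sub>1\<^sup>m \<noteq> 0\<close> for \<open>1 \<le> m \<le> n\<close>. Since \<open>e\<^sub>1 T\<^sub>1 f = - (e\<^sub>2 T\<^sub>2 + e\<^sub>3 T\<^sub>3) f\<close>,
  the operators \<open>Y\<close> and \<open>Z\<close> become lower and upper bidiagonal in the monomials \<open>x\<^sub>2\<^sup>n\<^sup>-\<^sup>j x\<^sub>3\<^sup>j\<close>. The two eigenspaces of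
  \<open>e\<^sub>3 R\<^sub>3\<close>, which commutes with the action, give two isomorphic copies. As \<open>T\<^sub>3 x\<^sub>3\<^sup>t = 0\<close> for \<open>t = t\<^sub>3\<close>,
  the monomials with \<open>j \<ge> t\<^sub>3\<close> span the submodule \<open>\<M>\<^sub>n(x\<^sub>3)\<close> and those with \<open>j < t\<^sub>3\<close> a basis of the quotient.

  A bidiagonal module with eigenvalues \<open>\<theta>\<^sub>i, \<theta>\<^sup>*\<^sub>i\<close> and products \<open>\<phi>\<^sub>i\<close> is irreducible as soon as the \<open>\<phi>\<^sub>i\<close> and the
  products belonging to the reversed order of the \<open>\<theta>\<^sub>i\<close> do not vanish. For the second form of \<open>W\<^sub>1, W\<^sub>2\<close>, start from the
  eigenvector of \<open>X\<close> for \<open>\<theta>\<^sub>0\<close> and apply \<open>Z - \<gamma>\<^sub>0\<close>, \<open>Z - \<gamma>\<^sub>1\<close>, \<open>\<dots>\<close>; the relations force \<open>X\<close> to be upper bidiagonal on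
  the resulting vectors, and the chain stops since the next vector would be an eigenvector of \<open>X\<close> for a number
  that is not an eigenvalue. Schur's lemma makes the resulting homomorphism bijective.
\<close>

section \<open>Dunkl monogenics and restriction to a hyperplane\<close>

text \<open>\<open>T\<^sub>i x\<^sub>i\<^sup>m = dnum k\<^sub>i m \<cdot> x\<^sub>i\<^sup>m\<^sup>-\<^sup>1\<close>.\<close>
definition dnum :: "real \<Rightarrow> nat \<Rightarrow> complex" where
  "dnum \<kappa> m = of_nat m + of_real \<kappa> * (1 - (-1) ^ m)"

lemma dnum_0 [simp]: "dnum \<kappa> 0 = 0"
  by (simp add: dnum_def)

lemma dnum_parity:
  "even m \<Longrightarrow> dnum \<kappa> m = of_nat m" "odd m \<Longrightarrow> dnum \<kappa> m = of_nat m + 2 * of_real \<kappa>"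
  by (simp_all add: dnum_def)

lemma kf_simps [simp]: "kf k1 k2 k3 1 = k1" "kf k1 k2 k3 (Suc 0) = k1" "kf k1 k2 k3 2 = k2" "kf k1 k2 k3 3 = k3"
  by (simp_all add: kf_def)

lemma dunkl_apply:
  "dunkl k i p x = dnum (k i) (Suc (expo i x)) * p (setexp i (Suc (expo i x)) x)"
proof -
  have "expo i (setexp i m x) = m" for m
    by (cases x) (simp add: expo_def setexp_def)
  then show ?thesis
    by (simp add: dunkl_def vadd_def vsc_def vsub_def pderiv_x_def divx_def refl_x_def dnum_def algebra_simps)
qed

lemma dunkl_simps:
  "dunkl k 1 p (s, a, b, c) = dnum (k 1) (Suc a) * p (s, Suc a, b, c)"
  "dunkl k (Suc 0) p (s, a, b, c) = dnum (k 1) (Suc a) * p (s, Suc a, b, c)"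
  "dunkl k 2 p (s, a, b, c) = dnum (k 2) (Suc b) * p (s, a, Suc b, c)"
  "dunkl k 3 p (s, a, b, c) = dnum (k 3) (Suc c) * p (s, a, b, Suc c)"
  by (simp_all add: dunkl_apply expo_def setexp_def)

lemma mulx_simps:
  "mulx 1 p (s, a, b, c) = (if a = 0 then 0 else p (s, a - 1, b, c))"
  "mulx (Suc 0) p (s, a, b, c) = (if a = 0 then 0 else p (s, a - 1, b, c))"
  "mulx 2 p (s, a, b, c) = (if b = 0 then 0 else p (s, a, b - 1, c))"
  "mulx 3 p (s, a, b, c) = (if c = 0 then 0 else p (s, a, b, c - 1))"
  by (simp_all add: mulx_def expo_def setexp_def)

lemma refl_x_simps:
  "refl_x 1 p (s, a, b, c) = (-1) ^ a * p (s, a, b, c)"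
  "refl_x (Suc 0) p (s, a, b, c) = (-1) ^ a * p (s, a, b, c)"
  "refl_x 2 p (s, a, b, c) = (-1) ^ b * p (s, a, b, c)"
  "refl_x 3 p (s, a, b, c) = (-1) ^ c * p (s, a, b, c)"
  by (simp_all add: refl_x_def expo_def)

lemma less_2_cases_nat: "(s::nat) < 2 \<Longrightarrow> (s = 0 \<Longrightarrow> P) \<Longrightarrow> (s = 1 \<Longrightarrow> P) \<Longrightarrow> P"
  by linarith

text \<open>Multiplying by \<open>e_1\<close> and using \<open>e_1 e_2 = i e_3\<close>,
  \<open>e_1 e_3 = - i e_2\<close> gives \<open>T_1 f = i e_2 T_3 f - i e_3 T_2 f\<close>. Of the
  two matrices only \<open>e_2\<close> exchanges the spinor components, hence \<open>1 - s\<close>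
  in the \<open>T_3\<close> term.\<close>

lemma dirac_eq_0_iff:
  "dirac (kf k1 k2 k3) p = vzero \<longleftrightarrow>
   (\<forall>s<2. \<forall>a b c. dnum k1 (Suc a) * p (s, Suc a, b, c)
      = (-1) ^ s * (dnum k3 (Suc c) * p (1 - s, a, b, Suc c) - \<i> * dnum k2 (Suc b) * p (s, a, Suc b, c)))"
  (is "_ \<longleftrightarrow> (\<forall>s<2. \<forall>a b c. ?R s a b c)")
proof -
  let ?D = "dirac (kf k1 k2 k3) p"
  have 0: "?D (0, a, b, c) = dnum k1 (Suc a) * p (1, Suc a, b, c)
      - \<i> * dnum k2 (Suc b) * p (1, a, Suc b, c) + dnum k3 (Suc c) * p (0, a, b, Suc c)" for a b c
    by (simp add: dirac_def vadd_def cliff_def dunkl_simps)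
  have 1: "?D (1, a, b, c) = dnum k1 (Suc a) * p (0, Suc a, b, c)
      + \<i> * dnum k2 (Suc b) * p (0, a, Suc b, c) - dnum k3 (Suc c) * p (1, a, b, Suc c)" for a b c
    by (simp add: dirac_def vadd_def cliff_def dunkl_simps)
  have 2: "?D (s, a, b, c) = 0" if "\<not> s < 2" for s a b c
    using that by (simp add: dirac_def vadd_def cliff_def)
  have "?R 0 a b c \<longleftrightarrow> ?D (1, a, b, c) = 0" for a b c
    unfolding 1 by (auto simp: algebra_simps)
  moreover have "?R 1 a b c \<longleftrightarrow> ?D (0, a, b, c) = 0" for a b c
    unfolding 0 by (auto simp: algebra_simps add_eq_0_iff)
  moreover have "?D = vzero \<longleftrightarrow> (\<forall>s a b c. ?D (s, a, b, c) = 0)"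
    by (auto simp: vzero_def fun_eq_iff)
  moreover have "(\<forall>s a b c. ?D (s, a, b, c) = 0) \<longleftrightarrow> (\<forall>a b c. ?D (0, a, b, c) = 0 \<and> ?D (1, a, b, c) = 0)"
    using 2 by (metis less_2_cases_nat)
  moreover have "(\<forall>s<2. \<forall>a b c. ?R s a b c) \<longleftrightarrow> (\<forall>a b c. ?R 0 a b c \<and> ?R 1 a b c)"
    by (metis less_2_cases_nat one_less_numeral_iff semiring_norm(76) zero_less_numeral)
  ultimately show ?thesis by metis
qed

lemma Mn_rec:
  assumes "p \<in> Mn (kf k1 k2 k3) n" "s < 2"
  shows "dnum k1 (Suc a) * p (s, Suc a, b, c)
      = (-1) ^ s * (dnum k3 (Suc c) * p (1 - s, a, b, Suc c) - \<i> * dnum k2 (Suc b) * p (s, a, Suc b, c))"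
  using assms by (auto simp: Mn_def dirac_eq_0_iff)

lemma Mn_support: "p \<in> Mn k n \<Longrightarrow> \<not> (s < 2 \<and> a + b + c = n) \<Longrightarrow> p (s, a, b, c) = 0"
  unfolding Mn_def hom_space_def by (auto simp: comp_def tdeg_def expo_def)

section \<open>Extension from the hyperplane \<open>x_1 = 0\<close>\<close>

fun ck_ext :: "real \<Rightarrow> real \<Rightarrow> real \<Rightarrow> nat \<Rightarrow> (nat \<Rightarrow> nat \<Rightarrow> complex) \<Rightarrow> nat \<Rightarrow> nat \<Rightarrow> nat \<Rightarrow> nat \<Rightarrow> complex" where
  "ck_ext k1 k2 k3 n w s 0 b c = (if s < 2 \<and> b + c = n then w s c else 0)"
| "ck_ext k1 k2 k3 n w s (Suc a) b c = (if s < 2 then (-1) ^ s * (dnum k3 (Suc c) * ck_ext k1 k2 k3 n w (1 - s) a b (Suc c)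
      - \<i> * dnum k2 (Suc b) * ck_ext k1 k2 k3 n w s a (Suc b) c) / dnum k1 (Suc a) else 0)"

lemma ck_ext_support: "\<not> (s < 2 \<and> a + b + c = n) \<Longrightarrow> ck_ext k1 k2 k3 n w s a b c = 0"
  by (induction a arbitrary: s b c) auto

text \<open>\<open>ck_ext\<close> is the Cauchy-Kovalevskaya series: each step in the exponent of
  \<open>x_1\<close> is solved by dividing by \<open>dnum k1\<close>. The boundary values
  \<open>w\<close> are arbitrary, which later makes the coordinate maps surjective.\<close>

lemma ck_extension:
  assumes "\<And>m. 1 \<le> m \<Longrightarrow> m \<le> n \<Longrightarrow> dnum k1 m \<noteq> 0"
  shows "\<exists>p\<in>Mn (kf k1 k2 k3) n. \<forall>s<2. \<forall>j\<le>n. p (s, 0, n - j, j) = w s j"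
proof
  let ?f = "ck_ext k1 k2 k3 n w"
  let ?p = "\<lambda>(s, a, b, c). ?f s a b c"
  show "\<forall>s<2. \<forall>j\<le>n. ?p (s, 0, n - j, j) = w s j" by simp
  have "dnum k1 (Suc a) * ?f s (Suc a) b c
      = (-1) ^ s * (dnum k3 (Suc c) * ?f (1 - s) a b (Suc c) - \<i> * dnum k2 (Suc b) * ?f s a (Suc b) c)"
    if "s < 2" for s a b c
  proof (cases "Suc a \<le> n")
    case True
    then show ?thesis using assms[of "Suc a"] that by simp
  next
    \<comment> \<open>Here \<open>dnum k1 (Suc a)\<close> may vanish and the division in
      \<open>ck_ext\<close> says nothing; both sides are zero because the total exponent exceeds
      \<open>n\<close>.\<close>
    case False
    then show ?thesis using that by (simp add: ck_ext_support del: ck_ext.simps)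
  qed
  then have "dirac (kf k1 k2 k3) ?p = vzero"
    unfolding dirac_eq_0_iff by (simp del: ck_ext.simps)
  moreover have "?p \<in> hom_space n"
    unfolding hom_space_def using ck_ext_support
    by (fastforce simp: comp_def tdeg_def expo_def simp del: ck_ext.simps)
  ultimately show "?p \<in> Mn (kf k1 k2 k3) n" by (simp add: Mn_def)
qed

text \<open>Truncation at an exponent of \<open>x\<^sub>3\<close> where \<open>dnum k3\<close> vanishes propagates from \<open>x\<^sub>1 = 0\<close> to
  the whole polynomial; \<open>t = Suc n\<close> gives injectivity of the restriction to \<open>x\<^sub>1 = 0\<close>.\<close>

lemma Mn_vanish:
  assumes p: "p \<in> Mn (kf k1 k2 k3) n"
    and nz: "\<And>m. 1 \<le> m \<Longrightarrow> m \<le> n \<Longrightarrow> dnum k1 m \<noteq> 0"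
    and t: "dnum k3 t = 0 \<or> t > n"
    and z: "\<And>s j. s < 2 \<Longrightarrow> j \<le> n \<Longrightarrow> j < t \<Longrightarrow> p (s, 0, n - j, j) = 0"
    and c: "c < t"
  shows "p (s, a, b, c) = 0"
proof (cases "s < 2 \<and> a + b + c = n")
  case True
  then show ?thesis using c
  proof (induction a arbitrary: s b c)
    case 0
    then show ?case using z[of s c] by (metis add_0 add_diff_cancel_right' le_add2)
  next
    case (Suc a)
    have "p (s, a, Suc b, c) = 0" using Suc.prems by (intro Suc.IH) auto
    \<comment> \<open>Only \<open>Suc c = t\<close> would leave the range of the induction
      hypothesis; there either \<open>dnum k3 t\<close> vanishes or \<open>t > n\<close> contradicts
      the degree.\<close>
    moreover have "dnum k3 (Suc c) * p (1 - s, a, b, Suc c) = 0"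
    proof (cases "Suc c = t")
      case True
      then show ?thesis using t Suc.prems by auto
    next
      case False
      then show ?thesis using Suc.prems Suc.IH[of "1 - s" b "Suc c"] by simp
    qed
    ultimately have "dnum k1 (Suc a) * p (s, Suc a, b, c) = 0"
      using Suc.prems Mn_rec[OF p, of s a b c] by simp
    then show ?case using nz[of "Suc a"] Suc.prems by simp
  qed
qed (use Mn_support[OF p] in blast)

section \<open>The generators restricted to \<open>x_1 = 0\<close>\<close>

text \<open>\<open>X\<close> involves neither \<open>x_1\<close> nor \<open>T_1\<close>, so it
  commutes with setting \<open>x_1 = 0\<close>. Since \<open>b + c\<close> is even,
  \<open>R_2 R_3\<close> acts as the identity there and \<open>R_2\<close>, \<open>R_3\<close> act
  by the same sign.\<close>

lemma M_module_X_restr: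
  assumes p: "p \<in> Mn (kf k1 k2 k3) (b + c)" and n: "even (b + c)" and s: "s < 2"
  shows "bm_X (M_module (kf k1 k2 k3) m) p (s, 0, b, c) =
    (1 / 2 + (-1) ^ c * (of_real k2 + of_real k3)) * p (s, 0, b, c)
    + \<i> * (if c = 0 then 0 else dnum k2 (Suc b) * p (1 - s, 0, Suc b, c - 1))
    - \<i> * (if b = 0 then 0 else dnum k3 (Suc c) * p (1 - s, 0, b - 1, Suc c))"
proof -
  have par: "(-1::complex) ^ b = (-1) ^ c" using n by (simp add: minus_one_power_iff)
  show ?thesis using s
    apply (cases b; cases c)
       apply (auto elim!: less_2_cases_nat simp: M_module_def gen_op_def Let_def vadd_def vsub_def vsc_def cliff_def ang_def
        dunkl_simps mulx_simps refl_x_simps par algebra_simps)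
    using par apply (auto simp: algebra_simps minus_one_power_iff split: if_splits)
    done
qed

text \<open>At \<open>x_1 = 0\<close> the term \<open>x_1 T_3\<close> drops out and
  \<open>Mn_rec\<close> rewrites \<open>x_3 T_1\<close>: its \<open>T_3\<close> part is diagonal,
  its \<open>T_2\<close> part couples to the next lower exponent of \<open>x_3\<close>. The
  reflection terms combine with \<open>dnum k3 c\<close> into one diagonal formula for both
  parities.\<close>

lemma M_module_Y_restr:
  assumes p: "p \<in> Mn (kf k1 k2 k3) n" and s: "s < 2"
  shows "bm_Y (M_module (kf k1 k2 k3) m) p (s, 0, b, c) =
    (-1) ^ c * (of_nat c + of_real k1 + of_real k3 + 1 / 2) * p (s, 0, b, c)
    - \<i> * (-1) ^ c * (if c = 0 then 0 else dnum k2 (Suc b) * p (1 - s, 0, Suc b, c - 1))"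
proof (cases c)
  case 0
  then show ?thesis using s
    by (auto elim!: less_2_cases_nat simp: M_module_def gen_op_def Let_def vadd_def vsub_def vsc_def cliff_def ang_def
        dunkl_simps mulx_simps refl_x_simps algebra_simps)
next
  case (Suc c')
  show ?thesis using s Mn_rec[OF p, of 0 0 b c'] Mn_rec[OF p, of 1 0 b c']
    apply (auto elim!: less_2_cases_nat simp: Suc M_module_def gen_op_def Let_def vadd_def vsub_def vsc_def cliff_def ang_def
        dunkl_simps mulx_simps refl_x_simps )
     apply (auto simp: algebra_simps dnum_def minus_one_power_iff split: if_splits)
    done
qed

text \<open>The same substitution for \<open>x_2 T_1\<close>: now the \<open>T_2\<close> part is
  diagonal and the \<open>T_3\<close> part couples to the next higher exponent of
  \<open>x_3\<close>, so \<open>Y\<close> and \<open>Z\<close> are bidiagonal in opposite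
  directions.\<close>

lemma M_module_Z_restr:
  assumes p: "p \<in> Mn (kf k1 k2 k3) n" and s: "s < 2"
  shows "bm_Z (M_module (kf k1 k2 k3) m) p (s, 0, b, c) =
    (-1) ^ b * (of_nat b + of_real k1 + of_real k2 + 1 / 2) * p (s, 0, b, c)
    + \<i> * (-1) ^ b * (if b = 0 then 0 else dnum k3 (Suc c) * p (1 - s, 0, b - 1, Suc c))"
proof (cases b)
  case 0
  then show ?thesis using s
    by (auto elim!: less_2_cases_nat simp: M_module_def gen_op_def Let_def vadd_def vsub_def vsc_def cliff_def ang_def
        dunkl_simps mulx_simps refl_x_simps algebra_simps)
next
  case (Suc b')
  have rec: "\<i> * (dnum k1 1 * p (r, 1, b', c))
      = (-1) ^ r * (\<i> * (dnum k3 (Suc c) * p (1 - r, 0, b', Suc c)) + dnum k2 (Suc b') * p (r, 0, Suc b', c))"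
    if "r < 2" for r
    using arg_cong[OF Mn_rec[OF p that, of 0 b' c], of "\<lambda>z. \<i> * z"] by (simp add: algebra_simps)
  have eq: "(-1) ^ s * (\<i> * (dnum k1 1 * p (s, 1, b', c)))
      = \<i> * (dnum k3 (Suc c) * p (1 - s, 0, b', Suc c)) + dnum k2 b * p (s, 0, b, c)"
    unfolding rec[OF s] Suc by (simp flip: mult.assoc power_add)
  have "bm_Z (M_module (kf k1 k2 k3) m) p (s, 0, b, c) = (-1) ^ b * ((-1) ^ s * (\<i> * (dnum k1 1 * p (s, 1, b', c))))
      + (-1) ^ b * (1 / 2 + of_real k1) * p (s, 0, b, c) + of_real k2 * p (s, 0, b, c)"
    using s
    by (auto elim!: less_2_cases_nat simp: Suc M_module_def gen_op_def Let_def vadd_def vsub_def vsc_def cliff_def ang_def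
        dunkl_simps mulx_simps refl_x_simps algebra_simps)
  then show ?thesis
    unfolding eq by (cases "even b") (simp_all add: dnum_parity(1)[of "Suc b'"] dnum_parity(2)[of "Suc b'"] Suc algebra_simps eq_neg_iff_add_eq_0)
qed

section \<open>Bidiagonal modules\<close>

text \<open>The cofactors \<open>a\<close>, \<open>b\<close>, \<open>c\<close>, \<open>e\<close>,
  \<open>f\<close> act as a certificate: once they are given, only a polynomial identity remains to
  be checked, and no combination of the relations has to be searched for.\<close>

lemma eq_by_combination:
  fixes x y :: "'a :: comm_ring"
  assumes "x - y = a * (l1 - r1) + b * (l2 - r2) + c * (l3 - r3) + e * (l4 - r4) + f * (l5 - r5)"
    and "l1 = r1" "l2 = r2" "l3 = r3" "l4 = r4" "l5 = r5"
  shows "x = y"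
  using assms by simp

section \<open>Linear operators and bidiagonal arrays\<close>

definition linear_op :: "((nat \<Rightarrow> complex) \<Rightarrow> (nat \<Rightarrow> complex)) \<Rightarrow> bool" where
  "linear_op A \<longleftrightarrow> (\<forall>a b u w. A (\<lambda>x. a * u x + b * w x) = (\<lambda>x. a * A u x + b * A w x))"

lemma linear_op2: "linear_op A \<Longrightarrow> A (\<lambda>x. a * u x + b * w x) = (\<lambda>x. a * A u x + b * A w x)"
  unfolding linear_op_def by blast

lemma linear_op3:
  assumes "linear_op A"
  shows "A (\<lambda>x. a * u x + b * w x + c * z x) = (\<lambda>x. a * A u x + b * A w x + c * A z x)"
  using linear_op2[OF assms, of 1 "\<lambda>x. a * u x + b * w x" c z] linear_op2[OF assms, of a u b w] by simp

lemma linear_op_scale: "linear_op A \<Longrightarrow> A (\<lambda>x. a * u x) = (\<lambda>x. a * A u x)"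
  using linear_op2[of A a u 0 u] by simp

lemma linear_op_zero: "linear_op A \<Longrightarrow> A (\<lambda>x. 0) = (\<lambda>x. 0)"
  using linear_op2[of A 0 _ 0 _] by simp

lemma linear_op_sum:
  assumes "linear_op A" "finite I"
  shows "A (\<lambda>x. \<Sum>i\<in>I. c i * u i x) = (\<lambda>x. \<Sum>i\<in>I. c i * A (u i) x)"
  using assms(2)
proof induction
  case empty
  then show ?case using linear_op_zero[OF assms(1)] by simp
next
  case (insert j I)
  then show ?case
    using linear_op2[OF assms(1), of "c j" "u j" 1 "\<lambda>x. \<Sum>i\<in>I. c i * u i x"] by simp
qed

lemma linear_op_bd_lower: "linear_op (bd_lower d \<alpha>)"
  by (auto simp: linear_op_def bd_lower_def fun_eq_iff algebra_simps)

lemma linear_op_bd_upper: "linear_op (bd_upper d \<beta> \<psi>)"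
  by (auto simp: linear_op_def bd_upper_def fun_eq_iff algebra_simps)

definition fin_space :: "nat \<Rightarrow> (nat \<Rightarrow> complex) set" where
  "fin_space d = {v. \<forall>i>d. v i = 0}"

text \<open>\<open>A v\<^sub>i = v\<^sub>i\<^sub>+\<^sub>1 + \<alpha>\<^sub>i v\<^sub>i\<close> and \<open>B v\<^sub>i = \<beta>\<^sub>i v\<^sub>i + \<psi>\<^sub>i v\<^sub>i\<^sub>-\<^sub>1\<close> satisfy
  \<open>{A, C} = B + \<mu>\<close> and \<open>{B, C} = A + \<nu>\<close> for \<open>C = {A, B} - \<kappa>\<close> as soon as the following scalar
  identities hold; they are the matrix coefficients of these two relations.\<close>

locale bi_array =
  fixes d :: nat and \<alpha> \<beta> \<psi> :: "nat \<Rightarrow> complex" and \<kappa> \<nu> \<mu> :: complex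
  assumes psi_0: "\<psi> 0 = 0" and psi_end: "\<psi> (Suc d) = 0"
    and alpha_sq: "(\<alpha> i + \<alpha> (Suc i))\<^sup>2 = 1" and beta_sq: "(\<beta> i + \<beta> (Suc i))\<^sup>2 = 1"
    and alpha_rec: "\<alpha> (Suc (Suc i)) = - 2 * \<alpha> (Suc i) - \<alpha> i"
    and beta_rec: "\<beta> (Suc (Suc i)) = - 2 * \<beta> (Suc i) - \<beta> i"
    and psi_rec: "\<psi> (Suc (Suc i)) = 2 * \<kappa> - 3 * \<alpha> i * \<beta> i - 3 * \<alpha> (Suc i) * \<beta> (Suc i)
      - \<alpha> i * \<beta> (Suc i) - \<alpha> (Suc i) * \<beta> i - 2 * \<psi> (Suc i) - \<psi> i"
    and psi_alpha: "\<beta> i * (4 * (\<alpha> i)\<^sup>2 - 1) + \<psi> (Suc i) * (3 * \<alpha> i + \<alpha> (Suc i)) + \<psi> i * (\<alpha> i - \<alpha> (Suc i))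
      = \<mu> + 2 * \<kappa> * \<alpha> i"
    and psi_beta: "\<alpha> i * (4 * (\<beta> i)\<^sup>2 - 1) + \<psi> (Suc i) * (3 * \<beta> i + \<beta> (Suc i)) + \<psi> i * (\<beta> i - \<beta> (Suc i))
      = \<nu> + 2 * \<kappa> * \<beta> i"

text \<open>This is the sign automorphism that negates \<open>A\<close> and \<open>C\<close>. It is
  needed for even \<open>d\<close>, where reversing the eigenvalues leads to the negative of a
  sequence of the same family.\<close>

lemma bi_array_neg:
  assumes "bi_array d \<alpha> \<beta> \<psi> \<kappa> \<nu> \<mu>"
  shows "bi_array d (\<lambda>i. - \<alpha> i) \<beta> (\<lambda>i. - \<psi> i) (- \<kappa>) (- \<nu>) \<mu>"
proof -
  interpret bi_array d \<alpha> \<beta> \<psi> \<kappa> \<nu> \<mu> by fact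
  show ?thesis
  proof
    fix i
    show "(- \<alpha> i + - \<alpha> (Suc i))\<^sup>2 = 1" using alpha_sq[of i] by algebra
    show "\<beta> i * (4 * (- \<alpha> i)\<^sup>2 - 1) + - \<psi> (Suc i) * (3 * - \<alpha> i + - \<alpha> (Suc i)) + - \<psi> i * (- \<alpha> i - - \<alpha> (Suc i))
      = \<mu> + 2 * - \<kappa> * - \<alpha> i" using psi_alpha[of i] by algebra
    show "- \<alpha> i * (4 * (\<beta> i)\<^sup>2 - 1) + - \<psi> (Suc i) * (3 * \<beta> i + \<beta> (Suc i)) + - \<psi> i * (\<beta> i - \<beta> (Suc i))
      = - \<nu> + 2 * - \<kappa> * \<beta> i" using psi_beta[of i] by algebra
    show "- \<psi> (Suc (Suc i)) = 2 * - \<kappa> - 3 * - \<alpha> i * \<beta> i - 3 * - \<alpha> (Suc i) * \<beta> (Suc i)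
      - - \<alpha> i * \<beta> (Suc i) - - \<alpha> (Suc i) * \<beta> i - 2 * - \<psi> (Suc i) - - \<psi> i" using psi_rec[of i] by algebra
  qed (simp_all add: psi_0 psi_end alpha_rec beta_rec beta_sq)
qed

text \<open>The hypothesis \<open>rel\<close> is \<open>{A, {A, B} - \<kappa>} = B + \<mu>\<close>
  written out. On \<open>v i\<close> it determines \<open>B (v (i + 2))\<close> from
  \<open>B (v i)\<close> and \<open>B (v (i + 1))\<close>, so the two starting values fix
  \<open>B\<close> on the whole chain, and the scalar identities of \<open>bi_array\<close> identify
  the result.\<close>

lemma (in bi_array) verma:
  assumes A: "linear_op A" and B: "linear_op B"
    and step: "\<And>i. v (Suc i) = (\<lambda>x. A (v i) x - \<alpha> i * v i x)"
    and b0: "B (v 0) = (\<lambda>x. \<beta> 0 * v 0 x)"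
    and b1: "B (v 1) = (\<lambda>x. \<beta> 1 * v 1 x + \<psi> 1 * v 0 x)"
    and rel: "\<And>i x. B (A (A (v i))) x + 2 * A (B (A (v i))) x + A (A (B (v i))) x
        = B (v i) x + \<mu> * v i x + 2 * \<kappa> * A (v i) x"
  shows "B (v i) = (\<lambda>x. \<beta> i * v i x + \<psi> i * v (i - 1) x)"
proof -
  let ?P = "\<lambda>i. B (v i) = (\<lambda>x. \<beta> i * v i x + \<psi> i * v (i - 1) x)"
  have Av: "A (v i) = (\<lambda>x. 1 * v (Suc i) x + \<alpha> i * v i x)" for i
    using step[of i] by (simp add: fun_eq_iff)
  have AAv: "A (A (v i)) = (\<lambda>x. 1 * v (Suc (Suc i)) x + (\<alpha> i + \<alpha> (Suc i)) * v (Suc i) x + (\<alpha> i)\<^sup>2 * v i x)" for i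
    by (simp only: Av linear_op2[OF A]) (auto simp: fun_eq_iff algebra_simps power2_eq_square)
  have "?P i \<and> ?P (Suc i)"
  proof (induction i)
    case 0
    then show ?case using b0 b1 psi_0 by simp
  next
    case (Suc i)
    then have Bv: "B (v i) = (\<lambda>x. \<beta> i * v i x + \<psi> i * v (i - 1) x)"
      and Bv': "B (v (Suc i)) = (\<lambda>x. \<beta> (Suc i) * v (Suc i) x + \<psi> (Suc i) * v i x)" by simp_all
    \<comment> \<open>The factor \<open>\<psi> i\<close> is kept because \<open>i - 1\<close>
      truncates at \<open>i = 0\<close>, where \<open>\<psi> 0 = 0\<close>.\<close>
    have pA: "\<psi> i * A (v (i - 1)) x = \<psi> i * (v i x + \<alpha> (i - 1) * v (i - 1) x)" for x
      using psi_0 Av[of "i - 1"] by (cases i) simp_all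
    have pAA: "\<psi> i * A (A (v (i - 1))) x = \<psi> i * (v (Suc i) x + (\<alpha> (i - 1) + \<alpha> i) * v i x + (\<alpha> (i - 1))\<^sup>2 * v (i - 1) x)" for x
      using psi_0 AAv[of "i - 1"] by (cases i) simp_all
    have 1: "B (A (A (v i))) x = B (v (Suc (Suc i))) x + (\<alpha> i + \<alpha> (Suc i)) * (\<beta> (Suc i) * v (Suc i) x + \<psi> (Suc i) * v i x)
        + (\<alpha> i)\<^sup>2 * (\<beta> i * v i x + \<psi> i * v (i - 1) x)" for x
      by (simp only: AAv linear_op3[OF B] Bv Bv') simp
    have BA: "B (A (v i)) = (\<lambda>x. \<beta> (Suc i) * v (Suc i) x + (\<psi> (Suc i) + \<alpha> i * \<beta> i) * v i x + (\<alpha> i * \<psi> i) * v (i - 1) x)"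
      by (simp only: Av linear_op2[OF B] Bv Bv') (auto simp: fun_eq_iff algebra_simps)
    have 2: "A (B (A (v i))) x = \<beta> (Suc i) * (v (Suc (Suc i)) x + \<alpha> (Suc i) * v (Suc i) x)
        + (\<psi> (Suc i) + \<alpha> i * \<beta> i) * (v (Suc i) x + \<alpha> i * v i x) + \<alpha> i * (\<psi> i * (v i x + \<alpha> (i - 1) * v (i - 1) x))" for x

    proof -
      have "A (B (A (v i))) x = \<beta> (Suc i) * A (v (Suc i)) x + (\<psi> (Suc i) + \<alpha> i * \<beta> i) * A (v i) x
          + (\<alpha> i * \<psi> i) * A (v (i - 1)) x"
        by (simp only: BA linear_op3[OF A])
      then show ?thesis using pA[of x] fun_cong[OF Av[of i], of x] fun_cong[OF Av[of "Suc i"], of x] by algebra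
    qed
    have AB: "A (A (B (v i))) = (\<lambda>x. \<beta> i * A (A (v i)) x + \<psi> i * A (A (v (i - 1))) x)"
      by (simp only: Bv linear_op2[OF A])
    have 3: "A (A (B (v i))) x = \<beta> i * (v (Suc (Suc i)) x + (\<alpha> i + \<alpha> (Suc i)) * v (Suc i) x + (\<alpha> i)\<^sup>2 * v i x)
        + \<psi> i * (v (Suc i) x + (\<alpha> (i - 1) + \<alpha> i) * v i x + (\<alpha> (i - 1))\<^sup>2 * v (i - 1) x)" for x
      using fun_cong[OF AB, of x] fun_cong[OF AAv[of i], of x] pAA[of x] by algebra
    have 4: "\<psi> i * ((\<alpha> (i - 1) + \<alpha> i)\<^sup>2 - 1) = 0" "\<psi> i * (\<alpha> (Suc i) + 2 * \<alpha> i + \<alpha> (i - 1)) = 0"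
      using psi_0 alpha_sq[of "i - 1"] alpha_rec[of "i - 1"] by (cases i; simp)+
    have "B (v (Suc (Suc i))) x = \<beta> (Suc (Suc i)) * v (Suc (Suc i)) x + \<psi> (Suc (Suc i)) * v (Suc i) x" for x
    proof -
      note rel' = rel[of i x, unfolded 1 2 3 fun_cong[OF Bv] fun_cong[OF Av]]
      \<comment> \<open>\<open>rel'\<close> contains \<open>B (v (i + 2))\<close> with coefficient
        one; the surplus coefficients of \<open>v i\<close> and \<open>v (i - 1)\<close> cancel by
        \<open>psi_alpha\<close> and the facts \<open>4\<close>.\<close>
      show ?thesis unfolding beta_rec psi_rec
        by (rule eq_by_combination[where a = 1 and b = "- v i x" and c = "- v i x" and e = "- v (i - 1) x" and f = 0,
              OF _ rel' psi_alpha[of i] 4(2) 4(1) refl[of 0]]) algebra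
    qed
    then show ?case using Suc by auto
  qed
  then show ?thesis by simp
qed

context bi_array
begin

abbreviation L where "L \<equiv> bd_lower d \<alpha>"
abbreviation U where "U \<equiv> bd_upper d \<beta> \<psi>"

definition C where "C v = (\<lambda>i. L (U v) i + U (L v) i - \<kappa> * v i)"

lemma L_apply: "L v i = (if i \<le> d then \<alpha> i * v i + (if i = 0 then 0 else v (i - 1)) else 0)"
  by (simp add: bd_lower_def)

lemma U_apply: "U v i = (if i \<le> d then \<beta> i * v i + \<psi> (Suc i) * v (Suc i) else 0)"
  using psi_end by (auto simp: bd_upper_def le_Suc_eq not_less_eq_eq dest: antisym)

text \<open>The factor \<open>\<psi> (Suc i)\<close> absorbs the truncation at the last basis
  vector: for \<open>i = d\<close> both sides vanish by \<open>psi_end\<close>.\<close>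

lemma psi_L: "i \<le> d \<Longrightarrow> \<psi> (Suc i) * L v (Suc i) = \<psi> (Suc i) * (\<alpha> (Suc i) * v (Suc i) + v i)"
  using psi_end by (cases "i = d") (auto simp: L_apply)

lemma psi_U: "i \<le> d \<Longrightarrow> \<psi> (Suc i) * U v (Suc i) = \<psi> (Suc i) * (\<beta> (Suc i) * v (Suc i) + \<psi> (Suc (Suc i)) * v (Suc (Suc i)))"
  using psi_end by (cases "i = d") (auto simp: U_apply)

lemma L_fin: "L v \<in> fin_space d" and U_fin: "U v \<in> fin_space d"
  by (simp_all add: fin_space_def bd_lower_def bd_upper_def)

lemma C_fin: "v \<in> fin_space d \<Longrightarrow> C v \<in> fin_space d"
  using L_fin U_fin by (simp add: fin_space_def C_def)

lemma linear_op_C: "linear_op C"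
  unfolding linear_op_def C_def
  by (simp add: linear_op2[OF linear_op_bd_lower] linear_op2[OF linear_op_bd_upper] fun_eq_iff algebra_simps)

lemma L_C: "L (C v) = (\<lambda>x. 1 * L (L (U v)) x + 1 * L (U (L v)) x + (- \<kappa>) * L v x)"
  using linear_op3[OF linear_op_bd_lower[of d \<alpha>], of 1 "L (U v)" 1 "U (L v)" "- \<kappa>" v] by (simp add: C_def)

text \<open>With \<open>rel_UC\<close> and the definition of \<open>C\<close> this makes the
  bidiagonal operators satisfy the Bannai-Ito relations with central values \<open>\<mu>\<close>,
  \<open>\<nu>\<close>, \<open>\<kappa>\<close>. The rows \<open>0\<close>, \<open>1\<close> and
  beyond are separate because two applications of \<open>L\<close> reach back two indices.\<close>

lemma rel_LC:
  assumes "v \<in> fin_space d"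
  shows "L (C v) i + C (L v) i = U v i + \<mu> * v i"
proof (cases "i \<le> d")
  case True
  have "U (L (L v)) i + 2 * L (U (L v)) i + L (L (U v)) i = U v i + \<mu> * v i + 2 * \<kappa> * L v i"
  proof -
    have 1: "U v i = \<beta> i * v i + \<psi> (Suc i) * v (Suc i)" using True by (simp add: U_apply[of _ i])
    have 2: "U (L v) i = \<beta> i * L v i + \<psi> (Suc i) * (\<alpha> (Suc i) * v (Suc i) + v i)"
      unfolding psi_L[OF True, symmetric] using True by (simp add: U_apply[of "L v" i])
    have 3: "U (L (L v)) i = \<beta> i * L (L v) i + (\<alpha> (Suc i) * (\<psi> (Suc i) * (\<alpha> (Suc i) * v (Suc i) + v i)) + \<psi> (Suc i) * L v i)"
    proof -
      have "U (L (L v)) i = \<beta> i * L (L v) i + (\<alpha> (Suc i) * (\<psi> (Suc i) * L v (Suc i)) + \<psi> (Suc i) * L v i)"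
        using True psi_L[OF True, of "L v"] by (simp add: U_apply[of "L (L v)" i] algebra_simps)
      then show ?thesis unfolding psi_L[OF True] .
    qed
    show ?thesis
    proof (cases i)
      case 0
      have 4: "L w i = \<alpha> i * w i" for w using 0 by (simp add: L_apply)
      have "\<psi> i = 0" using 0 psi_0 by simp
      then show ?thesis unfolding 3 2 4 1 using psi_alpha[of i] alpha_sq[of i] by algebra
    next
      case (Suc j)
      have 4: "L w i = \<alpha> i * w i + w j" for w using Suc True by (simp add: L_apply)
      have 5: "U w j = \<beta> j * w j + \<psi> i * w i" for w using Suc True by (simp add: U_apply)
      have 6: "(\<alpha> j + \<alpha> i)\<^sup>2 = 1" "\<alpha> (Suc i) = - 2 * \<alpha> i - \<alpha> j"
        "\<psi> (Suc i) = 2 * \<kappa> - 3 * \<alpha> j * \<beta> j - 3 * \<alpha> i * \<beta> i - \<alpha> j * \<beta> i - \<alpha> i * \<beta> j - 2 * \<psi> i - \<psi> j"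
        using alpha_sq[of j] alpha_rec[of j] psi_rec[of j] Suc by simp_all
      show ?thesis
      proof (cases j)
        case 0
        have 7: "L w j = \<alpha> j * w j" for w using 0 by (simp add: L_apply)
        have z: "\<psi> j = 0" using 0 psi_0 by simp
        show ?thesis unfolding 3 2 4 5 7 1
          by (rule eq_by_combination[where a = "\<psi> (Suc i) * v (Suc i)" and b = "v i" and c = "\<psi> i * v i"
                and e = "v j" and f = "- v j", OF _ alpha_sq[of i] psi_alpha[of i] 6(2) 6(3) z]) algebra
      next
        case (Suc l)
        have 7: "L w j = \<alpha> j * w j + w l" "U w l = \<beta> l * w l + \<psi> j * w j" for w
          using Suc \<open>i = Suc j\<close> True by (simp_all add: L_apply U_apply)
        have z: "\<beta> i = - 2 * \<beta> j - \<beta> l" using beta_rec[of l] Suc \<open>i = Suc j\<close> by simp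
        show ?thesis unfolding 3 2 4 5 7 1
          by (rule eq_by_combination[where a = "\<psi> (Suc i) * v (Suc i)" and b = "v i" and c = "\<psi> i * v i"
                and e = "v j" and f = "v l", OF _ alpha_sq[of i] psi_alpha[of i] 6(2) 6(3) z]) algebra
      qed
    qed
  qed
  then show ?thesis by (simp add: L_C) (simp add: C_def algebra_simps)
next
  case False
  then show ?thesis using assms C_fin L_fin U_fin by (simp add: fin_space_def C_def L_apply U_apply)
qed

lemma psi_psi_L: "i \<le> d \<Longrightarrow> \<psi> (Suc i) * (\<psi> (Suc (Suc i)) * L v (Suc (Suc i)))
    = \<psi> (Suc i) * (\<psi> (Suc (Suc i)) * (\<alpha> (Suc (Suc i)) * v (Suc (Suc i)) + v (Suc i)))"
  using psi_end psi_L[of "Suc i" v] by (cases "i = d") auto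

text \<open>The counterpart for \<open>U\<close>: two applications of \<open>U\<close> reach forward
  to \<open>i + 2\<close>, where \<open>psi_psi_L\<close> handles the truncation. Backwards only the
  index \<open>i - 1\<close> occurs, so two cases suffice.\<close>

lemma rel_UC:
  assumes "v \<in> fin_space d"
  shows "U (C v) i + C (U v) i = L v i + \<nu> * v i"
proof (cases "i \<le> d")
  case True
  have UC: "U (C v) = (\<lambda>x. 1 * U (L (U v)) x + 1 * U (U (L v)) x + (- \<kappa>) * U v x)"
    using linear_op3[OF linear_op_bd_upper[of d \<beta> \<psi>], of 1 "L (U v)" 1 "U (L v)" "- \<kappa>" v] by (simp add: C_def)
  have "U (U (L v)) i + 2 * U (L (U v)) i + L (U (U v)) i = L v i + \<nu> * v i + 2 * \<kappa> * U v i"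
  proof -
    note Ui = U_apply[of _ i]
    have 1: "U (U (L v)) i = \<beta> i * (\<beta> i * L v i + \<psi> (Suc i) * (\<alpha> (Suc i) * v (Suc i) + v i))
        + \<psi> (Suc i) * (\<beta> (Suc i) * (\<alpha> (Suc i) * v (Suc i) + v i)
          + \<psi> (Suc (Suc i)) * (\<alpha> (Suc (Suc i)) * v (Suc (Suc i)) + v (Suc i)))"
    proof -
      have "U (U (L v)) i = \<beta> i * (\<beta> i * L v i + \<psi> (Suc i) * L v (Suc i)) + \<psi> (Suc i) * U (L v) (Suc i)"
        using True by (simp add: Ui)
      also have "\<psi> (Suc i) * U (L v) (Suc i) = \<beta> (Suc i) * (\<psi> (Suc i) * L v (Suc i)) + \<psi> (Suc i) * (\<psi> (Suc (Suc i)) * L v (Suc (Suc i)))"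
        unfolding psi_U[OF True] by (simp add: algebra_simps)
      finally show ?thesis unfolding psi_L[OF True] psi_psi_L[OF True] by (simp add: algebra_simps)
    qed
    have 2: "U (L (U v)) i = \<beta> i * L (U v) i + (\<alpha> (Suc i) * (\<psi> (Suc i) * (\<beta> (Suc i) * v (Suc i) + \<psi> (Suc (Suc i)) * v (Suc (Suc i))))
         + \<psi> (Suc i) * U v i)"
    proof -
      have "U (L (U v)) i = \<beta> i * L (U v) i + (\<alpha> (Suc i) * (\<psi> (Suc i) * U v (Suc i)) + \<psi> (Suc i) * U v i)"
        using True psi_L[OF True, of "U v"] by (simp add: Ui[of "L (U v)"] algebra_simps)
      then show ?thesis unfolding psi_U[OF True] .
    qed
    have 3: "U (U v) i = \<beta> i * U v i + \<psi> (Suc i) * (\<beta> (Suc i) * v (Suc i) + \<psi> (Suc (Suc i)) * v (Suc (Suc i)))"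
      unfolding psi_U[OF True, symmetric] using True by (simp add: Ui[of "U v"])
    have 4: "U v i = \<beta> i * v i + \<psi> (Suc i) * v (Suc i)" using True by (simp add: Ui)
    show ?thesis
    proof (cases i)
      case 0
      have 5: "L v i = \<alpha> i * v i" "L (U v) i = \<alpha> i * U v i" "L (U (U v)) i = \<alpha> i * U (U v) i"
        using 0 by (simp_all add: L_apply)
      have "\<psi> i = 0" using 0 psi_0 by simp
      then show ?thesis unfolding 1 2 3 4 5
        using psi_beta[of i] psi_rec[of i] alpha_rec[of i] beta_rec[of i] by algebra
    next
      case (Suc j)
      have 5: "L v i = \<alpha> i * v i + v j" "L (U v) i = \<alpha> i * U v i + U v j" "L (U (U v)) i = \<alpha> i * U (U v) i + U (U v) j"
        using Suc True by (simp_all add: L_apply)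
      have 6: "U v j = \<beta> j * v j + \<psi> i * v i" "U (U v) j = \<beta> j * U v j + \<psi> i * U v i"
        using Suc True by (simp_all add: U_apply[of _ j])
      have 7: "\<beta> (Suc i) = - 2 * \<beta> i - \<beta> j" "(\<beta> j + \<beta> i)\<^sup>2 = 1"
        using beta_rec[of j] beta_sq[of j] Suc by simp_all
      show ?thesis unfolding 1 2 3 4 5 6
        by (rule eq_by_combination[where a = "\<psi> (Suc i) * \<psi> (Suc (Suc i)) * v (Suc (Suc i))" and b = "\<psi> (Suc i) * v (Suc i)"
                and c = "v i" and e = "\<psi> i * v i" and f = "v j",
              OF _ alpha_rec[of i] psi_rec[of i] psi_beta[of i] 7]) algebra
    qed
  qed
  then show ?thesis by (simp add: UC) (simp add: C_def algebra_simps)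
next
  case False
  then show ?thesis using assms C_fin L_fin U_fin by (simp add: fin_space_def C_def L_apply U_apply)
qed

section \<open>Products of factors \<open>L - c\<close>\<close>

definition shift_op where "shift_op c v = (\<lambda>x. L v x - c * v x)"

lemma shift_op_linear: "linear_op (shift_op c)"
  unfolding linear_op_def shift_op_def by (simp add: linear_op2[OF linear_op_bd_lower] fun_eq_iff algebra_simps)

lemma fold_shift_linear: "linear_op (fold shift_op cs)"
proof (induction cs)
  case Nil
  then show ?case by (simp add: linear_op_def)
next
  case (Cons c cs)
  then show ?case by (simp add: linear_op_def linear_op2[OF shift_op_linear])
qed

lemma fold_shift_rev: "fold shift_op (rev cs) = fold shift_op cs"
proof (rule fold_rev)
  fix a b
  have "shift_op a (shift_op b v) = shift_op b (shift_op a v)" for v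
    unfolding shift_op_def
    using linear_op2[OF linear_op_bd_lower[of d \<alpha>], of 1 "L v" "- a" v] linear_op2[OF linear_op_bd_lower[of d \<alpha>], of 1 "L v" "- b" v]
    by (simp add: fun_eq_iff algebra_simps)
  then show "shift_op b \<circ> shift_op a = shift_op a \<circ> shift_op b" by auto
qed

text \<open>Cayley-Hamilton for a triangular matrix: on vectors supported from index
  \<open>m\<close> on, the factor \<open>L - \<alpha> m\<close> raises the lowest index by
  one.\<close>

lemma fold_shift_kill:
  assumes "v \<in> fin_space d" "\<And>j. j < m \<Longrightarrow> v j = 0" "m \<le> Suc d"
  shows "fold shift_op (map \<alpha> [m..<Suc d]) v = (\<lambda>x. 0)"
  using assms(3,1,2)
proof (induction m arbitrary: v rule: inc_induct)
  case base
  then show ?case by (auto simp: fin_space_def fun_eq_iff) (metis not_less_eq)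
next
  case (step m)
  have "fold shift_op (map \<alpha> [Suc m..<Suc d]) (shift_op (\<alpha> m) v) = (\<lambda>x. 0)"
  proof (rule step.IH)
    show "shift_op (\<alpha> m) v \<in> fin_space d"
      using step.prems(1) L_fin[of v] by (simp add: fin_space_def shift_op_def)
    show "shift_op (\<alpha> m) v j = 0" if "j < Suc m" for j
      using that step by (cases "j = m") (auto simp: shift_op_def L_apply)
  qed
  moreover have "[m..<Suc d] = m # [Suc m..<Suc d]" using step(2) by (simp add: upt_conv_Cons)
  ultimately show ?case by simp
qed

lemma rel_LLU:
  assumes "v \<in> fin_space d"
  shows "U (L (L v)) i + 2 * L (U (L v)) i + L (L (U v)) i = U v i + \<mu> * v i + 2 * \<kappa> * L v i"
  using rel_LC[OF assms, of i] by (simp add: L_C) (simp add: C_def algebra_simps)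

end

section \<open>Reversed eigenvalue order and invariant subspaces\<close>

definition unit_vec :: "nat \<Rightarrow> nat \<Rightarrow> complex" where
  "unit_vec i = (\<lambda>x. if x = i then 1 else 0)"

text \<open>The primed data describe the same module built on the first basis vector with the eigenvalues \<open>\<alpha>\<close>
  taken in the opposite order.\<close>

locale bi_pair = bi_array + opp: bi_array d \<alpha>' \<beta> \<psi>' \<kappa> \<nu> \<mu> for \<alpha>' \<psi>' +
  assumes opp_alpha: "i \<le> d \<Longrightarrow> \<alpha>' i = \<alpha> (d - i)"
    and opp_psi: "\<psi>' 1 = \<psi> 1 + (\<alpha> 0 - \<alpha>' 0) * (\<beta> 0 - \<beta> 1)"
    and psi_nonzero: "1 \<le> i \<Longrightarrow> i \<le> d \<Longrightarrow> \<psi> i \<noteq> 0"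
    and opp_psi_nonzero: "1 \<le> i \<Longrightarrow> i \<le> d \<Longrightarrow> \<psi>' i \<noteq> 0"
begin

primrec rev_vec :: "nat \<Rightarrow> nat \<Rightarrow> complex" where
  "rev_vec 0 = unit_vec 0"
| "rev_vec (Suc i) = shift_op (\<alpha>' i) (rev_vec i)"

lemma rev_vec_fin: "rev_vec i \<in> fin_space d"
proof (induction i)
  case (Suc i)
  then show ?case using L_fin[of "rev_vec i"] by (simp add: fin_space_def shift_op_def)
qed (simp add: fin_space_def unit_vec_def)

lemma rev_vec_fold: "m \<le> Suc d \<Longrightarrow> rev_vec m = fold shift_op (map (\<lambda>i. \<alpha> (d - i)) [0..<m]) (unit_vec 0)"
  by (induction m) (simp_all add: opp_alpha)

text \<open>All factors except \<open>L - \<alpha> 0\<close> have been applied. Hence the result is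
  an eigenvector for \<open>\<alpha> 0\<close>, and it is what survives of coordinate
  \<open>0\<close> in \<open>invariant_subspace_full\<close>.\<close>

lemma rev_vec_top: "rev_vec d = fold shift_op (map \<alpha> [1..<Suc d]) (unit_vec 0)"
proof -
  have "map (\<lambda>i. \<alpha> (d - i)) [0..<d] = rev (map \<alpha> [1..<Suc d])"
    by (rule nth_equalityI) (auto simp: rev_nth Suc_diff_Suc simp del: upt_Suc)
  then show ?thesis using rev_vec_fold[of d] fold_shift_rev by simp
qed

lemma unit_vec_fin: "i \<le> d \<Longrightarrow> unit_vec i \<in> fin_space d"
  by (simp add: fin_space_def unit_vec_def)

lemma rev_vec_end: "rev_vec (Suc d) = (\<lambda>x. 0)"
proof -
  have "map (\<lambda>i. \<alpha> (d - i)) [0..<Suc d] = rev (map \<alpha> [0..<Suc d])"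
    by (rule nth_equalityI) (auto simp: rev_nth simp del: upt_Suc)
  then have "rev_vec (Suc d) = fold shift_op (map \<alpha> [0..<Suc d]) (unit_vec 0)"
    unfolding rev_vec_fold[OF order_refl] by (simp only: fold_shift_rev)
  then show ?thesis using fold_shift_kill[of "unit_vec 0" 0] unit_vec_fin by simp
qed

lemma rev_vec_diag: "i \<le> d \<Longrightarrow> rev_vec i i = 1 \<and> (\<forall>j>i. rev_vec i j = 0)"
proof (induction i)
  case (Suc i)
  then show ?case by (auto simp: shift_op_def L_apply)
qed (simp add: unit_vec_def)

lemma L_rev_vec_top: "L (rev_vec d) = (\<lambda>x. \<alpha> 0 * rev_vec d x)"
  using rev_vec_end opp_alpha[of d] by (simp add: shift_op_def fun_eq_iff)

text \<open>\<open>rev_vec\<close> is a chain of the kind treated by \<open>verma\<close>, with the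
  eigenvalues in reversed order, so the opposite array governs it.\<close>

lemma U_rev_vec: "U (rev_vec i) = (\<lambda>x. \<beta> i * rev_vec i x + \<psi>' i * rev_vec (i - 1) x)"
proof (rule opp.verma[OF linear_op_bd_lower linear_op_bd_upper])
  show "rev_vec (Suc i) = (\<lambda>x. L (rev_vec i) x - \<alpha>' i * rev_vec i x)" for i
    by (simp add: shift_op_def)
  show "U (rev_vec 0) = (\<lambda>x. \<beta> 0 * rev_vec 0 x)"
    by (auto simp: U_apply unit_vec_def fun_eq_iff)
  show "U (rev_vec 1) = (\<lambda>x. \<beta> 1 * rev_vec 1 x + \<psi>' 1 * rev_vec 0 x)"
  proof (cases "d = 0")
    case True
    then have "rev_vec 1 = (\<lambda>x. 0)" "\<psi>' 1 = 0" using rev_vec_end opp.psi_end by (simp_all del: rev_vec.simps)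
    then show ?thesis using linear_op_zero[OF linear_op_bd_upper] by simp
  next
    case False
    have rv0: "rev_vec 0 x = (if x = 0 then 1 else 0)" for x by (simp add: unit_vec_def)
    have rv1: "rev_vec 1 x = (if x = 0 then \<alpha> 0 - \<alpha>' 0 else if x = 1 then 1 else 0)" for x
      using False by (simp add: shift_op_def unit_vec_def bd_lower_def)
    \<comment> \<open>Here \<open>opp_psi\<close> arises: it is the coefficient obtained from
      \<open>rev_vec 1 = unit_vec 1 + (\<alpha> 0 - \<alpha>' 0) unit_vec 0\<close>.\<close>
    have "U (rev_vec 1) x = \<beta> 1 * rev_vec 1 x + \<psi>' 1 * rev_vec 0 x" for x
    proof (cases "x = 0")
      case True
      then show ?thesis unfolding U_apply rv0 rv1 opp_psi by (simp add: algebra_simps)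
    next
      case x: False
      then show ?thesis unfolding U_apply rv0 rv1 using False by auto
    qed
    then show ?thesis ..
  qed
  show "U (L (L (rev_vec i))) x + 2 * L (U (L (rev_vec i))) x + L (L (U (rev_vec i))) x = U (rev_vec i) x + \<mu> * rev_vec i x + 2 * \<kappa> * L (rev_vec i) x" for i x
    by (rule rel_LLU[OF rev_vec_fin])
qed

text \<open>\<open>U\<close> pushes a nonzero vector down to one with nonzero coordinate
  \<open>0\<close>; a product of factors \<open>L - \<alpha> i\<close> turns that into
  \<open>rev_vec d\<close>; \<open>U\<close> descends along the reversed chain to
  \<open>unit_vec 0\<close>; \<open>L\<close> then generates everything. The two descents use the
  nonvanishing of \<open>\<psi>\<close> and of \<open>\<psi>'\<close>.\<close>

lemma invariant_subspace_full:
  assumes sub: "W \<subseteq> fin_space d"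
    and comb: "\<And>a b u w. u \<in> W \<Longrightarrow> w \<in> W \<Longrightarrow> (\<lambda>x. a * u x + b * w x) \<in> W"
    and LW: "\<And>u. u \<in> W \<Longrightarrow> L u \<in> W" and UW: "\<And>u. u \<in> W \<Longrightarrow> U u \<in> W"
    and u: "u \<in> W" "u \<noteq> (\<lambda>x. 0)"
  shows "W = fin_space d"
proof -
  have lower: "\<exists>w\<in>W. w 0 \<noteq> 0" if "w \<in> W" "w m \<noteq> 0" for w m
    using that
  proof (induction m arbitrary: w)
    case (Suc m)
    show ?case
    proof (cases "w m = 0")
      case True
      have "Suc m \<le> d" using Suc.prems sub unfolding fin_space_def by (metis (mono_tags, lifting) mem_Collect_eq not_le subsetD)
      then have "U w m \<noteq> 0" using Suc.prems True psi_nonzero[of "Suc m"] by (simp add: U_apply)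
      then show ?thesis using Suc.IH[OF UW[OF Suc.prems(1)]] by blast
    qed (use Suc in blast)
  qed blast
  from u(2) obtain m where "u m \<noteq> 0" by (auto simp: fun_eq_iff)
  then obtain w where w: "w \<in> W" "w 0 \<noteq> 0" using lower[OF u(1)] by blast
  have shift: "shift_op c v \<in> W" if "v \<in> W" for c v
    using comb[OF LW[OF that] that, of 1 "- c"] by (simp add: shift_op_def)
  have foldW: "fold shift_op cs v \<in> W" if "v \<in> W" for cs v
    using that by (induction cs arbitrary: v) (simp_all add: shift)
  \<comment> \<open>\<open>w'\<close> has no coordinate \<open>0\<close>, so the product over
    \<open>\<alpha> 1, ..., \<alpha> d\<close> kills it; what remains of \<open>w\<close> is
    \<open>w 0\<close> times \<open>rev_vec d\<close>.\<close>
  define w' where "w' = (\<lambda>x. 1 * w x + (- w 0) * unit_vec 0 x)"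
  define cs where "cs = map \<alpha> [1..<Suc d]"
  have "fold shift_op cs w' = (\<lambda>x. 0)"
    unfolding cs_def
  proof (rule fold_shift_kill)
    show "w' \<in> fin_space d" using w sub by (auto simp: w'_def fin_space_def unit_vec_def)
  qed (simp_all add: w'_def unit_vec_def)
  moreover have "fold shift_op cs w' = (\<lambda>x. 1 * fold shift_op cs w x + (- w 0) * rev_vec d x)"
    unfolding w'_def rev_vec_top cs_def[symmetric] by (rule linear_op2[OF fold_shift_linear])
  ultimately have "1 * fold shift_op cs w x + (- w 0) * rev_vec d x = 0" for x
    by (metis (mono_tags))
  then have "fold shift_op cs w = (\<lambda>x. w 0 * rev_vec d x)" by auto
  then have wrv: "(\<lambda>x. w 0 * rev_vec d x) \<in> W" using foldW[OF w(1), of cs] by simp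
  have rvd: "rev_vec d \<in> W" using comb[OF wrv wrv, of "1 / w 0" 0] w(2) by simp
  have rvW: "rev_vec (d - j) \<in> W" for j
  proof (induction j)
    case 0
    show ?case using rvd by simp
  next
    case (Suc j)
    show ?case
    proof (cases "j < d")
      case True
      define i where "i = d - j"
      have nz: "\<psi>' i \<noteq> 0" unfolding i_def using True by (intro opp_psi_nonzero) auto
      have IH: "rev_vec i \<in> W" using Suc by (simp add: i_def)
      have "1 / \<psi>' i * U (rev_vec i) x + - \<beta> i / \<psi>' i * rev_vec i x = rev_vec (i - 1) x" for x
        unfolding fun_cong[OF U_rev_vec] using nz by (simp add: field_simps)
      then have "rev_vec (i - 1) \<in> W" using comb[OF UW[OF IH] IH, of "1 / \<psi>' i" "- \<beta> i / \<psi>' i"] by presburger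
      then show ?thesis by (simp add: i_def)
    next
      case False
      then show ?thesis using Suc by simp
    qed
  qed
  have e0: "unit_vec 0 \<in> W" using rvW[of d] by simp
  have eW: "i \<le> d \<Longrightarrow> unit_vec i \<in> W" for i
  proof (induction i)
    case (Suc i)
    then have IH: "unit_vec i \<in> W" by simp
    have "unit_vec (Suc i) = (\<lambda>x. 1 * L (unit_vec i) x + (- \<alpha> i) * unit_vec i x)"
      using Suc.prems by (auto simp: L_apply unit_vec_def fun_eq_iff)
    then show ?case using comb[OF LW[OF IH] IH, of 1 "- \<alpha> i"] by simp
  qed (use e0 in simp)
  have full: "v \<in> W" if "\<And>i. m \<le> i \<Longrightarrow> v i = 0" "m \<le> Suc d" for m v
    using that
  proof (induction m arbitrary: v)
    case 0
    then have "v = (\<lambda>x. 0 * u x + 0 * u x)" by auto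
    then show ?case using comb[OF u(1) u(1), of 0 0] by simp
  next
    case (Suc m)
    define v' where "v' = (\<lambda>x. if x = m then 0 else v x)"
    have v': "v' \<in> W" using Suc.prems by (intro Suc.IH) (auto simp: v'_def)
    have eq: "(\<lambda>x. 1 * v' x + v m * unit_vec m x) = v" by (auto simp: v'_def unit_vec_def)
    have "m \<le> d" using Suc.prems(2) by simp
    from comb[OF v' eW[OF this], of 1 "v m"] show ?case unfolding eq .
  qed
  have "fin_space d \<subseteq> W"
  proof
    fix v
    assume "v \<in> fin_space d"
    then show "v \<in> W" by (intro full[of "Suc d"]) (simp_all add: fin_space_def)
  qed
  then show ?thesis using sub by blast
qed

end

section \<open>The modules \<open>E\<^sub>d\<close> and \<open>O\<^sub>d\<close>\<close>

text \<open>The subtraction is complex, not truncated as in \<open>E_mod\<close>, so that the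
  recursions of \<open>bi_array\<close> hold at every index, also beyond \<open>d\<close>.\<close>

definition phiE :: "nat \<Rightarrow> complex \<Rightarrow> complex \<Rightarrow> complex \<Rightarrow> nat \<Rightarrow> complex" where
  "phiE d a b c i = (if even i then of_nat i * (of_nat d - of_nat i + 1)
     else c ^ 2 - (2 * a + 2 * b - of_nat d + 2 * of_nat i - 1) ^ 2 / 4)"

definition phiO :: "nat \<Rightarrow> complex \<Rightarrow> complex \<Rightarrow> complex \<Rightarrow> nat \<Rightarrow> complex" where
  "phiO d a b c i = (if even i then of_nat i * (of_nat d + 1 - 2 * of_nat i - 2 * a - 2 * b - 2 * c) / 2
     else (of_nat i - of_nat d - 1) * (of_nat d + 1 - 2 * of_nat i - 2 * a - 2 * b + 2 * c) / 2)"

definition kapE :: "nat \<Rightarrow> complex \<Rightarrow> complex \<Rightarrow> complex \<Rightarrow> complex" where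
  "kapE d a b c = c ^ 2 - a ^ 2 - b ^ 2 + (of_nat d + 1) ^ 2 / 4"

definition kapO :: "nat \<Rightarrow> complex \<Rightarrow> complex \<Rightarrow> complex \<Rightarrow> complex" where
  "kapO d a b c = 2 * a * b - c * (of_nat d + 1)"

lemma theta_seq_sq: "(theta_seq a d i + theta_seq a d (Suc i))\<^sup>2 = 1"
  by (cases "even i") (simp_all add: theta_seq_def field_simps power2_eq_square)

lemma theta_seq_rec: "theta_seq a d (Suc (Suc i)) = - 2 * theta_seq a d (Suc i) - theta_seq a d i"
  by (cases "even i") (simp_all add: theta_seq_def field_simps)

text \<open>The central values of \<open>{X, Y} - Z\<close>, \<open>{Y, Z} - X\<close> and
  \<open>{Z, X} - Y\<close> are the cyclic rotations of one formula; the same happens for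
  \<open>kapO\<close>.\<close>

lemma bi_array_E:
  assumes "odd d"
  shows "bi_array d (theta_seq a d) (theta_seq b d) (phiE d a b c) (kapE d a b c) (kapE d b c a) (kapE d c a b)"
proof
  fix i
  show "phiE d a b c (Suc (Suc i)) = 2 * kapE d a b c - 3 * theta_seq a d i * theta_seq b d i
      - 3 * theta_seq a d (Suc i) * theta_seq b d (Suc i) - theta_seq a d i * theta_seq b d (Suc i)
      - theta_seq a d (Suc i) * theta_seq b d i - 2 * phiE d a b c (Suc i) - phiE d a b c i"
    by (cases "even i") (simp_all add: theta_seq_def phiE_def kapE_def field_simps power2_eq_square)
  show "theta_seq b d i * (4 * (theta_seq a d i)\<^sup>2 - 1) + phiE d a b c (Suc i) * (3 * theta_seq a d i + theta_seq a d (Suc i))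
      + phiE d a b c i * (theta_seq a d i - theta_seq a d (Suc i)) = kapE d c a b + 2 * kapE d a b c * theta_seq a d i"
    by (cases "even i") (simp_all add: theta_seq_def phiE_def kapE_def field_simps power2_eq_square)
  show "theta_seq a d i * (4 * (theta_seq b d i)\<^sup>2 - 1) + phiE d a b c (Suc i) * (3 * theta_seq b d i + theta_seq b d (Suc i))
      + phiE d a b c i * (theta_seq b d i - theta_seq b d (Suc i)) = kapE d b c a + 2 * kapE d a b c * theta_seq b d i"
    by (cases "even i") (simp_all add: theta_seq_def phiE_def kapE_def field_simps power2_eq_square)
qed (use assms in \<open>simp_all add: theta_seq_sq theta_seq_rec phiE_def\<close>)

lemma bi_array_O:
  assumes "even d"
  shows "bi_array d (theta_seq a d) (theta_seq b d) (phiO d a b c) (kapO d a b c) (kapO d b c a) (kapO d c a b)"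
proof
  fix i
  show "phiO d a b c (Suc (Suc i)) = 2 * kapO d a b c - 3 * theta_seq a d i * theta_seq b d i
      - 3 * theta_seq a d (Suc i) * theta_seq b d (Suc i) - theta_seq a d i * theta_seq b d (Suc i)
      - theta_seq a d (Suc i) * theta_seq b d i - 2 * phiO d a b c (Suc i) - phiO d a b c i"
    by (cases "even i") (simp_all add: theta_seq_def phiO_def kapO_def field_simps power2_eq_square)
  show "theta_seq b d i * (4 * (theta_seq a d i)\<^sup>2 - 1) + phiO d a b c (Suc i) * (3 * theta_seq a d i + theta_seq a d (Suc i))
      + phiO d a b c i * (theta_seq a d i - theta_seq a d (Suc i)) = kapO d c a b + 2 * kapO d a b c * theta_seq a d i"
    by (cases "even i") (simp_all add: theta_seq_def phiO_def kapO_def field_simps power2_eq_square)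
  show "theta_seq a d i * (4 * (theta_seq b d i)\<^sup>2 - 1) + phiO d a b c (Suc i) * (3 * theta_seq b d i + theta_seq b d (Suc i))
      + phiO d a b c i * (theta_seq b d i - theta_seq b d (Suc i)) = kapO d b c a + 2 * kapO d a b c * theta_seq b d i"
    by (cases "even i") (simp_all add: theta_seq_def phiO_def kapO_def field_simps power2_eq_square)
qed (use assms in \<open>simp_all add: theta_seq_sq theta_seq_rec phiO_def\<close>)

lemma tri_module_cong:
  assumes "\<And>i. 1 \<le> i \<Longrightarrow> i \<le> d \<Longrightarrow> ph i = ph' i"
  shows "tri_module d th ths ph \<kappa> = tri_module d th ths ph' \<kappa>"
proof -
  have "bd_upper d ths ph = bd_upper d ths ph'"
    using assms by (auto simp: bd_upper_def fun_eq_iff)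
  then show ?thesis by (simp add: tri_module_def)
qed

lemma E_mod_eq: "E_mod d a b c = tri_module d (theta_seq a d) (theta_seq b d) (phiE d a b c) (kapE d a b c)"
  unfolding E_mod_def kapE_def
proof (rule tri_module_cong)
  fix i :: nat
  assume "i \<le> d"
  then show "(if even i then of_nat (i * (d - i + 1))
      else c\<^sup>2 - (2 * a + 2 * b - of_nat d + 2 * of_nat i - 1)\<^sup>2 / 4) = phiE d a b c i"
    by (simp only: phiE_def of_nat_mult of_nat_add of_nat_diff of_nat_1)
qed

lemma O_mod_eq: "O_mod d a b c = tri_module d (theta_seq a d) (theta_seq b d) (phiO d a b c) (kapO d a b c)"
  unfolding O_mod_def kapO_def by (rule tri_module_cong) (auto simp: phiO_def)

text \<open>For odd \<open>d\<close>, reversing the eigenvalues amounts to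
  \<open>a \<mapsto> - a\<close>, and the central values are even in \<open>a\<close>; so the
  opposite array is that of \<open>E_d(-a, b, c)\<close>.\<close>

lemma bi_pair_E:
  assumes d: "odd d"
    and nz: "\<And>i. 1 \<le> i \<Longrightarrow> i \<le> d \<Longrightarrow> phiE d a b c i \<noteq> 0"
    and nz': "\<And>i. 1 \<le> i \<Longrightarrow> i \<le> d \<Longrightarrow> phiE d (- a) b c i \<noteq> 0"
  shows "bi_pair d (theta_seq a d) (theta_seq b d) (phiE d a b c) (kapE d a b c) (kapE d b c a) (kapE d c a b)
    (theta_seq (- a) d) (phiE d (- a) b c)"
proof -
  interpret bi_array d "theta_seq a d" "theta_seq b d" "phiE d a b c" "kapE d a b c" "kapE d b c a" "kapE d c a b"
    by (rule bi_array_E[OF d])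
  have "kapE d (- a) b c = kapE d a b c" "kapE d b c (- a) = kapE d b c a" "kapE d c (- a) b = kapE d c a b"
    by (simp_all add: kapE_def)
  then interpret opp: bi_array d "theta_seq (- a) d" "theta_seq b d" "phiE d (- a) b c" "kapE d a b c" "kapE d b c a" "kapE d c a b"
    using bi_array_E[OF d, of "- a" b c] by simp
  show ?thesis
  proof
    show "theta_seq (- a) d i = theta_seq a d (d - i)" if "i \<le> d" for i
      using that d by (cases "even i") (simp_all add: theta_seq_def of_nat_diff field_simps)
    show "phiE d (- a) b c 1 = phiE d a b c 1 + (theta_seq a d 0 - theta_seq (- a) d 0) * (theta_seq b d 0 - theta_seq b d 1)"
      by (simp add: phiE_def theta_seq_def field_simps power2_eq_square)
  qed (use nz nz' in auto)
qed

text \<open>For even \<open>d\<close>, reversing the eigenvalues gives the negative of the sequence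
  for \<open>- a\<close>. The change to \<open>- c\<close> compensates the sign in the central
  values, so the opposite array is that of \<open>O_d(-a, b, -c)\<close> after
  \<open>bi_array_neg\<close>.\<close>

lemma bi_pair_O:
  assumes d: "even d"
    and nz: "\<And>i. 1 \<le> i \<Longrightarrow> i \<le> d \<Longrightarrow> phiO d a b c i \<noteq> 0"
    and nz': "\<And>i. 1 \<le> i \<Longrightarrow> i \<le> d \<Longrightarrow> phiO d (- a) b (- c) i \<noteq> 0"
  shows "bi_pair d (theta_seq a d) (theta_seq b d) (phiO d a b c) (kapO d a b c) (kapO d b c a) (kapO d c a b)
    (\<lambda>i. - theta_seq (- a) d i) (\<lambda>i. - phiO d (- a) b (- c) i)"
proof -
  interpret bi_array d "theta_seq a d" "theta_seq b d" "phiO d a b c" "kapO d a b c" "kapO d b c a" "kapO d c a b"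
    by (rule bi_array_O[OF d])
  have "- kapO d (- a) b (- c) = kapO d a b c" "- kapO d b (- c) (- a) = kapO d b c a" "kapO d (- c) (- a) b = kapO d c a b"
    by (simp_all add: kapO_def)
  then interpret opp: bi_array d "\<lambda>i. - theta_seq (- a) d i" "theta_seq b d" "\<lambda>i. - phiO d (- a) b (- c) i"
      "kapO d a b c" "kapO d b c a" "kapO d c a b"
    using bi_array_neg[OF bi_array_O[OF d, of "- a" b "- c"]] by simp
  show ?thesis
  proof
    show "- theta_seq (- a) d i = theta_seq a d (d - i)" if "i \<le> d" for i
      using that d by (cases "even i") (simp_all add: theta_seq_def of_nat_diff field_simps)
    show "- phiO d (- a) b (- c) 1 = phiO d a b c 1
        + (theta_seq a d 0 - - theta_seq (- a) d 0) * (theta_seq b d 0 - theta_seq b d 1)"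
      by (simp add: phiO_def theta_seq_def field_simps)
  qed (use nz nz' in auto)
qed

section \<open>Cyclic rotation of the generators\<close>

lemma (in bi_array) L_eigen_zero:
  assumes "v \<in> fin_space d" "L v = (\<lambda>x. c * v x)" "\<And>i. i \<le> d \<Longrightarrow> \<alpha> i \<noteq> c"
  shows "v = (\<lambda>x. 0)"
proof -
  have "v i = 0" for i
  proof (induction i)
    case 0
    have "\<alpha> 0 * v 0 = c * v 0" using fun_cong[OF assms(2), of 0] by (simp add: L_apply)
    then show ?case using assms(3)[of 0] by simp
  next
    case (Suc i)
    show ?case
    proof (cases "Suc i \<le> d")
      case True
      have "\<alpha> (Suc i) * v (Suc i) = c * v (Suc i)" using fun_cong[OF assms(2), of "Suc i"] Suc True by (simp add: L_apply)
      then show ?thesis using assms(3)[OF True] by simp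
    qed (use assms(1) in \<open>simp add: fin_space_def\<close>)
  qed
  then show ?thesis by blast
qed

context bi_pair
begin

text \<open>\<open>C\<close> maps the eigenvector \<open>rev_vec d\<close> into the span of itself
  and \<open>rev_vec (d - 1)\<close>, and \<open>L - \<alpha> 1\<close> sends the latter to
  \<open>rev_vec d\<close>. The coefficient supplies the starting value required by
  \<open>verma\<close> for the rotated chain.\<close>

lemma L_C_rev_vec_top:
  "L (C (rev_vec d)) x - \<alpha> 1 * C (rev_vec d) x
    = (2 * \<alpha> 0 * (\<beta> d * (\<alpha> 0 - \<alpha> 1) + \<psi>' d) - \<kappa> * (\<alpha> 0 - \<alpha> 1)) * rev_vec d x"
proof -
  let ?r = "rev_vec (d - 1)"
  \<comment> \<open>The factor \<open>\<psi>' d\<close> covers \<open>d = 0\<close>, where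
    \<open>d - 1\<close> truncates.\<close>
  have r: "\<psi>' d * L ?r x = \<psi>' d * (rev_vec d x + \<alpha> 1 * ?r x)" for x
  proof (cases "d = 0")
    case True
    then show ?thesis using opp.psi_0 by simp
  next
    case False
    then have d: "Suc (d - 1) = d" "d - (d - 1) = 1" by auto
    have "rev_vec (Suc (d - 1)) = shift_op (\<alpha>' (d - 1)) ?r" by (rule rev_vec.simps(2))
    then have "rev_vec d = (\<lambda>x. L ?r x - \<alpha> 1 * ?r x)"
      unfolding opp_alpha[OF diff_le_self] d shift_op_def .
    then show ?thesis by (simp add: fun_eq_iff)
  qed
  have LU: "L (U (rev_vec d)) x = \<beta> d * \<alpha> 0 * rev_vec d x + \<psi>' d * (rev_vec d x + \<alpha> 1 * ?r x)" for x
    unfolding U_rev_vec linear_op2[OF linear_op_bd_lower] L_rev_vec_top r by simp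
  have UL: "U (L (rev_vec d)) x = \<alpha> 0 * (\<beta> d * rev_vec d x + \<psi>' d * ?r x)" for x
    unfolding L_rev_vec_top linear_op_scale[OF linear_op_bd_upper] U_rev_vec by simp
  have C: "C (rev_vec d) = (\<lambda>x. (2 * \<alpha> 0 * \<beta> d + \<psi>' d - \<kappa>) * rev_vec d x + (\<alpha> 0 + \<alpha> 1) * \<psi>' d * ?r x)"
    unfolding C_def LU UL by (simp add: fun_eq_iff algebra_simps)
  have "(\<alpha> 0 + \<alpha> 1) * \<psi>' d * L ?r x = (\<alpha> 0 + \<alpha> 1) * (\<psi>' d * (rev_vec d x + \<alpha> 1 * ?r x))"
    using r[of x] by (simp only: mult.assoc)
  then show ?thesis
    unfolding C linear_op2[OF linear_op_bd_lower] L_rev_vec_top by (simp add: algebra_simps)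
qed

text \<open>Eliminating \<open>U\<close> between \<open>rel_LC\<close> and \<open>rel_UC\<close>
  leaves a relation in \<open>C\<close> and \<open>L\<close> alone, of the shape that
  \<open>verma\<close> needs with \<open>C\<close> as the raising operator.\<close>

lemma rel_CCL:
  assumes "v \<in> fin_space d"
  shows "L (C (C v)) x + 2 * C (L (C v)) x + C (C (L v)) x = L v x + \<nu> * v x + 2 * \<mu> * C v x"
proof -
  have "(\<lambda>x. 1 * L (C v) x + 1 * C (L v) x) = (\<lambda>x. 1 * U v x + \<mu> * v x)"
    using rel_LC[OF assms] by simp
  then have "C (\<lambda>x. 1 * L (C v) x + 1 * C (L v) x) = C (\<lambda>x. 1 * U v x + \<mu> * v x)" by (rule arg_cong)
  then have "C (L (C v)) x + C (C (L v)) x = C (U v) x + \<mu> * C v x"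
    unfolding linear_op2[OF linear_op_C] by (simp add: fun_eq_iff)
  then show ?thesis
    using rel_LC[OF C_fin[OF assms], of x] rel_UC[OF assms, of x] by algebra
qed

text \<open>The triple \<open>(s Z, X, s Y)\<close> satisfies the same kind of relations as \<open>(X, Y, Z)\<close>; the target is the bidiagonal
  module generated by the eigenvector \<open>rev_vec d\<close> of the new second operator \<open>X\<close>.\<close>

lemma cyclic_iso:
  assumes tgt: "bi_pair d \<gamma> \<alpha> \<chi> (s * \<mu>) (s * \<kappa>) \<nu> \<gamma>' \<chi>'"
    and s: "s * s = 1"
    and base: "\<chi> 1 = s * (2 * \<alpha> 0 * (\<beta> d * (\<alpha> 0 - \<alpha> 1) + \<psi>' d) - \<kappa> * (\<alpha> 0 - \<alpha> 1)) - \<gamma> 0 * (\<alpha> 0 - \<alpha> 1)"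
    and sep: "\<And>i. i \<le> d \<Longrightarrow> \<alpha> i \<noteq> \<alpha> (Suc d)"
  shows "bimod_iso \<lparr>bm_carrier = fin_space d, bm_X = \<lambda>v. vsc s (C v), bm_Y = L, bm_Z = \<lambda>v. vsc s (U v)\<rparr>
    (tri_module d \<gamma> \<alpha> \<chi> (s * \<mu>))"
proof -
  interpret tgt: bi_pair d \<gamma> \<alpha> \<chi> "s * \<mu>" "s * \<kappa>" \<nu> \<gamma>' \<chi>' by (rule tgt)
  let ?S = "fin_space d"
  define A where "A v = (\<lambda>x. s * C v x)" for v
  have linA: "linear_op A"
    unfolding linear_op_def A_def by (simp add: linear_op2[OF linear_op_C] fun_eq_iff algebra_simps)
  have linL: "linear_op L" by (rule linear_op_bd_lower)
  have ss: "s * (s * z) = z" for z using s by (simp flip: mult.assoc)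
  \<comment> \<open>The chain starts at the \<open>L\<close>-eigenvector for
    \<open>\<alpha> 0\<close>, so that \<open>L\<close> becomes the upper bidiagonal operator on
    it.\<close>
  define u where "u = rec_nat (rev_vec d) (\<lambda>i w x. A w x - \<gamma> i * w x)"
  have u0: "u 0 = rev_vec d" and uS: "u (Suc i) = (\<lambda>x. A (u i) x - \<gamma> i * u i x)" for i
    by (simp_all add: u_def)
  have uF: "u i \<in> ?S" for i
  proof (induction i)
    case (Suc i)
    then show ?case using C_fin[OF Suc] by (simp add: uS fin_space_def A_def)
  qed (simp add: u0 rev_vec_fin)
  have Au: "A (u i) x = u (Suc i) x + \<gamma> i * u i x" for i x
    by (simp add: uS)
  have Lu: "L (u i) = (\<lambda>x. \<alpha> i * u i x + \<chi> i * u (i - 1) x)" for i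
  proof (rule tgt.verma[OF linA linL uS])
    show "L (u 0) = (\<lambda>x. \<alpha> 0 * u 0 x)" by (simp add: u0 L_rev_vec_top)
    show "L (u 1) = (\<lambda>x. \<alpha> 1 * u 1 x + \<chi> 1 * u 0 x)"
    proof
      fix x
      have u1: "u 1 = (\<lambda>x. s * C (rev_vec d) x + (- \<gamma> 0) * rev_vec d x)" by (simp add: uS u0 A_def)
      have "L (u 1) x - \<alpha> 1 * u 1 x = s * (L (C (rev_vec d)) x - \<alpha> 1 * C (rev_vec d) x) - \<gamma> 0 * (\<alpha> 0 - \<alpha> 1) * rev_vec d x"
        unfolding u1 linear_op2[OF linL] L_rev_vec_top by (simp add: algebra_simps)
      also have "\<dots> = \<chi> 1 * u 0 x"
        unfolding L_C_rev_vec_top base u0 by (simp add: algebra_simps)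
      finally show "L (u 1) x = \<alpha> 1 * u 1 x + \<chi> 1 * u 0 x" by (simp add: algebra_simps)
    qed
    show "L (A (A (u i))) x + 2 * A (L (A (u i))) x + A (A (L (u i))) x
        = L (u i) x + \<nu> * u i x + 2 * (s * \<mu>) * A (u i) x" for i x
      using rel_CCL[OF uF, of i x]
      by (simp add: A_def linear_op_scale[OF linear_op_C] linear_op_scale[OF linL] ss algebra_simps)
  qed
  \<comment> \<open>As \<open>\<chi> (Suc d) = 0\<close>, this vector would be an
    \<open>L\<close>-eigenvector for \<open>\<alpha> (Suc d)\<close>, which by \<open>sep\<close> is
    not on the diagonal of \<open>L\<close>.\<close>
  have u_end: "u (Suc d) = (\<lambda>x. 0)"
    by (rule L_eigen_zero[OF uF]) (use Lu[of "Suc d"] tgt.psi_end sep in auto)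
  \<comment> \<open>\<open>T\<close> maps the target to the source, sending its basis to the chain;
    the required isomorphism is its inverse.\<close>
  define T where "T x = (\<lambda>j. \<Sum>i\<le>d. x i * u i j)" for x
  have T2: "T (\<lambda>i. a * x i + b * y i) = (\<lambda>j. a * T x j + b * T y j)" for a b x y
    by (auto simp: T_def sum.distrib sum_distrib_left algebra_simps)
  have TF: "T x \<in> ?S" for x
    using uF by (simp add: T_def fin_space_def)
  have T_lower: "T (tgt.L x) = A (T x)" for x
  proof
    fix j
    have "(\<Sum>i\<le>d. (if i = 0 then 0 else x (i - 1)) * u i j) = (\<Sum>i<d. x i * u (Suc i) j)"
      by (simp add: sum.atMost_shift)
    also have "\<dots> = (\<Sum>i\<le>d. x i * u (Suc i) j)"
      using u_end by (simp flip: lessThan_Suc_atMost)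
    finally have shift: "(\<Sum>i\<le>d. (if i = 0 then 0 else x (i - 1)) * u i j) = (\<Sum>i\<le>d. x i * u (Suc i) j)" .
    have "T (tgt.L x) j = (\<Sum>i\<le>d. (\<gamma> i * x i + (if i = 0 then 0 else x (i - 1))) * u i j)"
      unfolding T_def by (rule sum.cong) (simp_all add: tgt.L_apply)
    also have "\<dots> = (\<Sum>i\<le>d. x i * A (u i) j)"
      using shift by (simp add: Au algebra_simps sum.distrib)
    also have "\<dots> = A (T x) j"
      unfolding T_def linear_op_sum[OF linA finite_atMost] ..
    finally show "T (tgt.L x) j = A (T x) j" .
  qed
  have T_upper: "T (tgt.U x) = L (T x)" for x
  proof
    fix j
    have "(\<Sum>i\<le>d. x i * (\<chi> i * u (i - 1) j)) = (\<Sum>i<d. x (Suc i) * (\<chi> (Suc i) * u i j))"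
      using tgt.psi_0 by (simp add: sum.atMost_shift)
    also have "\<dots> = (\<Sum>i\<le>d. x (Suc i) * (\<chi> (Suc i) * u i j))"
      using tgt.psi_end by (simp flip: lessThan_Suc_atMost)
    finally have shift: "(\<Sum>i\<le>d. x i * (\<chi> i * u (i - 1) j)) = (\<Sum>i\<le>d. x (Suc i) * (\<chi> (Suc i) * u i j))" .
    have "T (tgt.U x) j = (\<Sum>i\<le>d. (\<alpha> i * x i + \<chi> (Suc i) * x (Suc i)) * u i j)"
      unfolding T_def by (rule sum.cong) (simp_all add: tgt.U_apply)
    also have "\<dots> = (\<Sum>i\<le>d. x i * (\<alpha> i * u i j)) + (\<Sum>i\<le>d. x (Suc i) * (\<chi> (Suc i) * u i j))"
      by (simp add: algebra_simps sum.distrib)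
    also have "\<dots> = (\<Sum>i\<le>d. x i * L (u i) j)"
      unfolding shift[symmetric] Lu by (simp add: algebra_simps sum.distrib)
    also have "\<dots> = L (T x) j"
      unfolding T_def linear_op_sum[OF linL finite_atMost] ..
    finally show "T (tgt.U x) j = L (T x) j" .
  qed
  \<comment> \<open>The third generator is determined by the other two: \<open>rel_LC\<close>
    recovers \<open>U\<close> from the anticommutator of \<open>L\<close> and
    \<open>C\<close>.\<close>
  have T_C: "T (tgt.C x) = (\<lambda>j. s * U (T x) j)" for x
  proof
    fix j
    have eq: "tgt.C x = (\<lambda>i. 1 * (1 * tgt.L (tgt.U x) i + 1 * tgt.U (tgt.L x) i) + (- (s * \<mu>)) * x i)"
      by (simp add: tgt.C_def)
    have "T (tgt.C x) j = A (L (T x)) j + L (A (T x)) j - s * \<mu> * T x j"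
      unfolding eq T2 T_lower T_upper by simp
    also have "\<dots> = s * (L (C (T x)) j + C (L (T x)) j - \<mu> * T x j)"
      by (simp add: A_def linear_op_scale[OF linL] algebra_simps)
    also have "\<dots> = s * U (T x) j"
      unfolding rel_LC[OF TF] by simp
    finally show "T (tgt.C x) j = s * U (T x) j" .
  qed
  have u0_nz: "u 0 \<noteq> (\<lambda>x. 0)" using rev_vec_diag[of d] by (auto simp: u0 fun_eq_iff intro: exI[of _ d])
  have T_e0: "T (unit_vec 0) = u 0"
    by (simp add: T_def unit_vec_def sum.atMost_shift)
  \<comment> \<open>Schur's lemma, first half: a nonzero kernel would be an invariant subspace of
    the target, hence everything, although \<open>T (unit_vec 0) = u 0\<close> is nonzero.\<close>
  have ker: "x = (\<lambda>i. 0)" if "x \<in> ?S" "T x = (\<lambda>j. 0)" for x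
  proof (rule ccontr)
    assume "x \<noteq> (\<lambda>i. 0)"
    then have "{x \<in> ?S. T x = (\<lambda>j. 0)} = ?S"
      using that linear_op_zero[OF linA] linear_op_zero[OF linL]
      by (intro tgt.invariant_subspace_full[of _ x])
        (auto simp: T2 T_lower T_upper tgt.L_fin tgt.U_fin, auto simp: fin_space_def)
    then have "T (unit_vec 0) = (\<lambda>j. 0)" using tgt.unit_vec_fin[of 0] by blast
    then show False using u0_nz T_e0 by simp
  qed
  \<comment> \<open>Second half: the image is nonzero and invariant under \<open>L\<close> and
    \<open>U\<close>; since \<open>s * s = 1\<close>, \<open>U\<close> comes from
    \<open>tgt.C\<close>.\<close>
  have img: "T ` ?S = ?S"
  proof (rule invariant_subspace_full)
    show "u 0 \<in> T ` ?S" unfolding T_e0[symmetric] by (intro imageI unit_vec_fin) simp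
    show "(\<lambda>x. a * v x + b * w x) \<in> T ` ?S" if "v \<in> T ` ?S" "w \<in> T ` ?S" for a b v w
    proof -
      from that obtain x y where xy: "x \<in> ?S" "v = T x" "y \<in> ?S" "w = T y" by blast
      then have "(\<lambda>i. a * x i + b * y i) \<in> ?S" by (simp add: fin_space_def)
      then show ?thesis unfolding xy T2[symmetric] by blast
    qed
    show "L v \<in> T ` ?S" if v: "v \<in> T ` ?S" for v
    proof -
      obtain x where x: "x \<in> ?S" "v = T x" using v by blast
      show ?thesis unfolding x(2) T_upper[symmetric] by (rule imageI[OF tgt.U_fin])
    qed
    show "U v \<in> T ` ?S" if v: "v \<in> T ` ?S" for v
    proof -
      obtain x where x: "x \<in> ?S" "v = T x" using v by blast
      have 1: "T (\<lambda>i. s * tgt.C x i + 0 * x i) = U v"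
        unfolding T2 T_C using x by (simp add: ss)
      have 2: "(\<lambda>i. s * tgt.C x i + 0 * x i) \<in> ?S" using tgt.C_fin[OF x(1)] by (simp add: fin_space_def)
      show ?thesis unfolding 1[symmetric] using 2 by (rule imageI)
    qed
  qed (use u0_nz TF in auto)
  have inj: "inj_on T ?S"
  proof (rule inj_onI)
    fix x y
    assume xy: "x \<in> ?S" "y \<in> ?S" "T x = T y"
    have "(\<lambda>i. 1 * x i + (- 1) * y i) = (\<lambda>i. 0)"
      by (rule ker) (use xy in \<open>simp_all only: T2, simp_all add: fin_space_def\<close>)
    then show "x = y" by (simp add: fun_eq_iff)
  qed
  define f where "f = inv_into ?S T"
  have fS: "f v \<in> ?S" and Tf: "T (f v) = v" if "v \<in> ?S" for v
    using that img inv_into_into[of v T ?S] f_inv_into_f[of v T ?S] by (auto simp: f_def)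
  have fT: "f w = x" if "x \<in> ?S" "T x = w" for x w
    using that inj by (auto simp: f_def)
  show ?thesis
    unfolding bimod_iso_def
  proof (intro exI[of _ f] conjI)
    show "complex_linear_on (bm_carrier \<lparr>bm_carrier = ?S, bm_X = \<lambda>v. vsc s (C v), bm_Y = L, bm_Z = \<lambda>v. vsc s (U v)\<rparr>) f"
      unfolding complex_linear_on_def
    proof (intro conjI ballI allI)
      fix v w c
      assume "v \<in> bm_carrier \<lparr>bm_carrier = ?S, bm_X = \<lambda>v. vsc s (C v), bm_Y = L, bm_Z = \<lambda>v. vsc s (U v)\<rparr>"
      then have v: "v \<in> ?S" by simp
      show "f (vsc c v) = vsc c (f v)"
        using T2[of c "f v" 0 "f v"] fS[OF v] by (intro fT) (simp_all add: vsc_def Tf[OF v] fin_space_def)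
      assume "w \<in> bm_carrier \<lparr>bm_carrier = ?S, bm_X = \<lambda>v. vsc s (C v), bm_Y = L, bm_Z = \<lambda>v. vsc s (U v)\<rparr>"
      then have w: "w \<in> ?S" by simp
      show "f (vadd v w) = vadd (f v) (f w)"
        using T2[of 1 "f v" 1 "f w"] fS[OF v] fS[OF w]
        by (intro fT) (simp_all add: vadd_def Tf[OF v] Tf[OF w] fin_space_def)
    qed
    show "bij_betw f (bm_carrier \<lparr>bm_carrier = ?S, bm_X = \<lambda>v. vsc s (C v), bm_Y = L, bm_Z = \<lambda>v. vsc s (U v)\<rparr>)
        (bm_carrier (tri_module d \<gamma> \<alpha> \<chi> (s * \<mu>)))"
      using bij_betw_inv_into[of T ?S ?S] inj img
      by (simp add: f_def tri_module_def bij_betw_def flip: fin_space_def)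
    show "intertwines \<lparr>bm_carrier = ?S, bm_X = \<lambda>v. vsc s (C v), bm_Y = L, bm_Z = \<lambda>v. vsc s (U v)\<rparr>
        (tri_module d \<gamma> \<alpha> \<chi> (s * \<mu>)) f"
      unfolding intertwines_def
    proof (intro ballI)
      fix v
      assume "v \<in> bm_carrier \<lparr>bm_carrier = ?S, bm_X = \<lambda>v. vsc s (C v), bm_Y = L, bm_Z = \<lambda>v. vsc s (U v)\<rparr>"
      then have v: "v \<in> ?S" by simp
      have "f (vsc s (C v)) = tgt.L (f v)"
        by (rule fT[OF tgt.L_fin]) (simp add: T_lower Tf[OF v] A_def vsc_def)
      moreover have "f (L v) = tgt.U (f v)"
        by (rule fT[OF tgt.U_fin]) (simp add: T_upper Tf[OF v])
      moreover have "f (vsc s (U v)) = tgt.C (f v)"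
        by (rule fT[OF tgt.C_fin[OF fS[OF v]]]) (simp add: T_C Tf[OF v] vsc_def)
      ultimately show "f (bm_X \<lparr>bm_carrier = ?S, bm_X = \<lambda>v. vsc s (C v), bm_Y = L, bm_Z = \<lambda>v. vsc s (U v)\<rparr> v)
            = bm_X (tri_module d \<gamma> \<alpha> \<chi> (s * \<mu>)) (f v)
          \<and> f (bm_Y \<lparr>bm_carrier = ?S, bm_X = \<lambda>v. vsc s (C v), bm_Y = L, bm_Z = \<lambda>v. vsc s (U v)\<rparr> v)
            = bm_Y (tri_module d \<gamma> \<alpha> \<chi> (s * \<mu>)) (f v)
          \<and> f (bm_Z \<lparr>bm_carrier = ?S, bm_X = \<lambda>v. vsc s (C v), bm_Y = L, bm_Z = \<lambda>v. vsc s (U v)\<rparr> v)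
            = bm_Z (tri_module d \<gamma> \<alpha> \<chi> (s * \<mu>)) (f v)"
        by (simp add: tri_module_def tgt.C_def[abs_def])
    qed
  qed
qed

end

section \<open>Irreducibility and the second form of the modules\<close>

lemma fin_space_carrier: "bm_carrier (tri_module d th ths ph \<kappa>) = fin_space d"
  by (simp add: tri_module_def fin_space_def)

context bi_pair
begin

text \<open>Each twisted generator is a sign times one of \<open>L\<close>, \<open>U\<close>,
  \<open>C\<close>, and the sign squares to one, so a submodule of the twist is invariant under
  \<open>L\<close> and \<open>U\<close> themselves.\<close>

lemma irreducible_twist:
  assumes e: "fst e * fst e = 1" "snd e * snd e = 1"
  shows "bimod_irreducible (bm_twist e cyc132 (tri_module d \<alpha> \<beta> \<psi> \<kappa>))" (is "bimod_irreducible ?M")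
  unfolding bimod_irreducible_def
proof (intro conjI allI impI)
  have car: "bm_carrier ?M = fin_space d"
    by (simp add: bm_twist_def Let_def fin_space_carrier)
  have "unit_vec 0 0 \<noteq> vzero (0::nat)" by (simp add: unit_vec_def vzero_def)
  then have "unit_vec 0 \<noteq> vzero" by metis
  then show "bm_carrier ?M \<noteq> {vzero}" unfolding car using unit_vec_fin[of 0] by blast
  fix W
  assume W: "is_submodule ?M W"
  show "W = {vzero} \<or> W = bm_carrier ?M"
  proof (cases "\<exists>u\<in>W. u \<noteq> vzero")
    case True
    then obtain u where u: "u \<in> W" "u \<noteq> (\<lambda>x. 0)" by (auto simp: vzero_def)
    have sc: "vsc c w \<in> W" if "w \<in> W" for c w using W that by (simp add: is_submodule_def)
    have e': "sign_of e 1 * sign_of e 1 = 1" "sign_of e 2 * sign_of e 2 = 1"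
      using e by (simp_all add: sign_of_def flip: of_int_mult)
    have "W = fin_space d"
    proof (rule invariant_subspace_full[OF _ _ _ _ u])
      show "W \<subseteq> fin_space d" using W car by (simp add: is_submodule_def)
      show "(\<lambda>x. a * v x + b * w x) \<in> W" if "v \<in> W" "w \<in> W" for a b v w
        using sc[OF that(1), of a] sc[OF that(2), of b] W
        by (auto simp: is_submodule_def vadd_def vsc_def)
      show "L w \<in> W" if "w \<in> W" for w
      proof -
        have "vsc (sign_of e 1) (L w) \<in> W"
          using W that by (simp add: is_submodule_def bm_twist_def Let_def cyc132_def bm_gen_def tri_module_def)
        from sc[OF this, of "sign_of e 1"] show ?thesis using e' by (simp add: vsc_def flip: mult.assoc)
      qed
      show "U w \<in> W" if "w \<in> W" for w
      proof -
        have "vsc (sign_of e 2) (U w) \<in> W"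
          using W that by (simp add: is_submodule_def bm_twist_def Let_def cyc132_def bm_gen_def tri_module_def)
        from sc[OF this, of "sign_of e 2"] show ?thesis using e' by (simp add: vsc_def flip: mult.assoc)
      qed
    qed
    then show ?thesis using car by simp
  next
    case False
    then show ?thesis using W by (auto simp: is_submodule_def)
  qed
qed

end

text \<open>Equality with equal signs would force \<open>i = d + 1\<close>; with opposite signs it
  would force \<open>4 * r + 2 * i + 2 = 0\<close>, impossible for \<open>r \<ge> 0\<close>.\<close>

lemma theta_seq_real_separated:
  fixes r :: real
  assumes "r \<ge> 0" "i \<le> d"
  shows "theta_seq (of_real r) d i \<noteq> theta_seq (of_real r) d (Suc d)"
proof -
  have th: "theta_seq (of_real r) d j = of_real ((-1) ^ j * (2 * r - real d + 2 * real j) / 2)" for j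
    by (simp add: theta_seq_def)
  show ?thesis unfolding th of_real_eq_iff using assms
    by (cases "even i"; cases "even d") auto
qed

lemma phiE_nonzero:
  fixes a b c :: real
  assumes "1 \<le> i" "i \<le> d"
    and "2 * c \<noteq> 2 * a + 2 * b - real d + 2 * real i - 1" "2 * c \<noteq> - (2 * a + 2 * b - real d + 2 * real i - 1)"
  shows "phiE d (of_real a) (of_real b) (of_real c) i \<noteq> 0"
proof (cases "even i")
  case True
  have "real d - real i + 1 \<noteq> 0" using assms by linarith
  then have "complex_of_real (real i * (real d - real i + 1)) \<noteq> 0" using assms by (simp only: of_real_eq_0_iff) simp
  then show ?thesis using True by (simp add: phiE_def)
next
  case False
  have "phiE d (of_real a) (of_real b) (of_real c) i = of_real (c\<^sup>2 - (2 * a + 2 * b - real d + 2 * real i - 1)\<^sup>2 / 4)"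
    using False by (simp add: phiE_def)
  also have "c\<^sup>2 - (2 * a + 2 * b - real d + 2 * real i - 1)\<^sup>2 / 4
      = (2 * c - (2 * a + 2 * b - real d + 2 * real i - 1)) * (2 * c + (2 * a + 2 * b - real d + 2 * real i - 1)) / 4"
    by (simp add: field_simps power2_eq_square)
  finally have eq: "phiE d (of_real a) (of_real b) (of_real c) i = of_real
    ((2 * c - (2 * a + 2 * b - real d + 2 * real i - 1)) * (2 * c + (2 * a + 2 * b - real d + 2 * real i - 1)) / 4)" .
  show ?thesis unfolding eq of_real_eq_0_iff using assms by simp
qed

lemma phiO_nonzero:
  fixes a b c :: real
  assumes "1 \<le> i" "i \<le> d"
    and "even i \<Longrightarrow> real d + 1 - 2 * real i - 2 * a - 2 * b - 2 * c \<noteq> 0"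
    and "odd i \<Longrightarrow> real d + 1 - 2 * real i - 2 * a - 2 * b + 2 * c \<noteq> 0"
  shows "phiO d (of_real a) (of_real b) (of_real c) i \<noteq> 0"
proof (cases "even i")
  case True
  then have eq: "phiO d (of_real a) (of_real b) (of_real c) i
      = of_real (real i * (real d + 1 - 2 * real i - 2 * a - 2 * b - 2 * c) / 2)"
    by (simp add: phiO_def)
  show ?thesis unfolding eq of_real_eq_0_iff using assms True by simp
next
  case False
  then have eq: "phiO d (of_real a) (of_real b) (of_real c) i
      = of_real ((real i - real d - 1) * (real d + 1 - 2 * real i - 2 * a - 2 * b + 2 * c) / 2)"
    by (simp add: phiO_def)
  have "real i - real d - 1 \<noteq> 0" using assms by linarith
  then show ?thesis unfolding eq of_real_eq_0_iff using assms False by simp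
qed

text \<open>In both twists the first two generators carry the sign minus and the third the sign
  plus. These signs cancel, leaving \<open>cyclic_iso\<close> with \<open>s = 1\<close>.\<close>

lemma E_twist_iso:
  assumes 1: "bi_pair d (theta_seq a d) (theta_seq b d) (phiE d a b c) (kapE d a b c) (kapE d b c a) (kapE d c a b)
      (theta_seq (- a) d) (phiE d (- a) b c)"
    and 2: "bi_pair d (theta_seq (- c) d) (theta_seq a d) (phiE d (- c) a (- b)) (kapE d (- c) a (- b)) (kapE d a (- b) (- c))
      (kapE d (- b) (- c) a) \<gamma>' \<chi>'"
    and d: "odd d"
    and sep: "\<And>i. i \<le> d \<Longrightarrow> theta_seq a d i \<noteq> theta_seq a d (Suc d)"
  shows "bimod_iso (bm_twist (-1, 1) cyc132 (E_mod d a b c)) (bm_twist (-1, -1) id (E_mod d (- c) a (- b)))"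
proof -
  interpret bi_pair d "theta_seq a d" "theta_seq b d" "phiE d a b c" "kapE d a b c" "kapE d b c a" "kapE d c a b"
      "theta_seq (- a) d" "phiE d (- a) b c" by fact
  have kap: "kapE d (- c) a (- b) = 1 * kapE d c a b" "kapE d a (- b) (- c) = 1 * kapE d a b c" "kapE d (- b) (- c) a = kapE d b c a"
    by (simp_all add: kapE_def)
  have "bimod_iso \<lparr>bm_carrier = fin_space d, bm_X = \<lambda>v. vsc 1 (C v), bm_Y = L, bm_Z = \<lambda>v. vsc 1 (U v)\<rparr>
    (tri_module d (theta_seq (- c) d) (theta_seq a d) (phiE d (- c) a (- b)) (1 * kapE d c a b))"
  proof (rule cyclic_iso[OF 2[unfolded kap]])
    show "phiE d (- c) a (- b) 1 = 1 * (2 * theta_seq a d 0 *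
         (theta_seq b d d * (theta_seq a d 0 - theta_seq a d 1) + phiE d (- a) b c d) -
         kapE d a b c * (theta_seq a d 0 - theta_seq a d 1)) - theta_seq (- c) d 0 * (theta_seq a d 0 - theta_seq a d 1)"
      using d by (simp add: theta_seq_def phiE_def kapE_def field_simps power2_eq_square)
  qed (use sep in auto)
  then obtain f where f: "complex_linear_on (fin_space d) f" "bij_betw f (fin_space d) (fin_space d)"
    and X: "\<And>v. v \<in> fin_space d \<Longrightarrow> f (C v) = bm_X (E_mod d (- c) a (- b)) (f v)"
    and Y: "\<And>v. v \<in> fin_space d \<Longrightarrow> f (L v) = bm_Y (E_mod d (- c) a (- b)) (f v)"
    and Z: "\<And>v. v \<in> fin_space d \<Longrightarrow> f (U v) = bm_Z (E_mod d (- c) a (- b)) (f v)"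
    unfolding bimod_iso_def intertwines_def E_mod_eq kap by (auto simp: fin_space_carrier vsc_def)
  have fsc: "f (vsc k v) = vsc k (f v)" if "v \<in> fin_space d" for k v
    using f(1) that by (simp add: complex_linear_on_def)
  have C_eq: "bm_Z (tri_module d (theta_seq a d) (theta_seq b d) (phiE d a b c) (kapE d a b c)) = C"
      "bm_X (tri_module d (theta_seq a d) (theta_seq b d) (phiE d a b c) (kapE d a b c)) = L"
      "bm_Y (tri_module d (theta_seq a d) (theta_seq b d) (phiE d a b c) (kapE d a b c)) = U"
    by (simp_all add: fun_eq_iff tri_module_def C_def)
  show ?thesis
    unfolding bimod_iso_def
    by (intro exI[of _ f] conjI)
      (use f in \<open>auto simp: intertwines_def bm_twist_def Let_def cyc132_def bm_gen_def sign_of_def C_eq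
        E_mod_eq fin_space_carrier fsc C_fin L_fin U_fin X[unfolded E_mod_eq] Y[unfolded E_mod_eq] Z[unfolded E_mod_eq]\<close>)
qed

text \<open>Here \<open>X\<close> acts as \<open>- C\<close>, \<open>Y\<close> as \<open>L\<close>
  and \<open>Z\<close> as \<open>- U\<close>, which is \<open>cyclic_iso\<close> with
  \<open>s = - 1\<close>; the signs of the rotated central values agree with this.\<close>

lemma O_twist_iso:
  assumes 1: "bi_pair d (theta_seq a d) (theta_seq b d) (phiO d a b c) (kapO d a b c) (kapO d b c a) (kapO d c a b)
      (\<lambda>i. - theta_seq (- a) d i) (\<lambda>i. - phiO d (- a) b (- c) i)"
    and 2: "bi_pair d (theta_seq (- c) d) (theta_seq a d) (phiO d (- c) a (- b)) (kapO d (- c) a (- b)) (kapO d a (- b) (- c))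
      (kapO d (- b) (- c) a) \<gamma>' \<chi>'"
    and d: "even d"
    and sep: "\<And>i. i \<le> d \<Longrightarrow> theta_seq a d i \<noteq> theta_seq a d (Suc d)"
  shows "bimod_iso (bm_twist (1, -1) cyc132 (O_mod d a b c)) (O_mod d (- c) a (- b))"
proof -
  interpret bi_pair d "theta_seq a d" "theta_seq b d" "phiO d a b c" "kapO d a b c" "kapO d b c a" "kapO d c a b"
      "\<lambda>i. - theta_seq (- a) d i" "\<lambda>i. - phiO d (- a) b (- c) i" by fact
  have kap: "kapO d (- c) a (- b) = (- 1) * kapO d c a b" "kapO d a (- b) (- c) = (- 1) * kapO d a b c" "kapO d (- b) (- c) a = kapO d b c a"
    by (simp_all add: kapO_def)
  have "bimod_iso \<lparr>bm_carrier = fin_space d, bm_X = \<lambda>v. vsc (- 1) (C v), bm_Y = L, bm_Z = \<lambda>v. vsc (- 1) (U v)\<rparr>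
    (tri_module d (theta_seq (- c) d) (theta_seq a d) (phiO d (- c) a (- b)) ((- 1) * kapO d c a b))"
  proof (rule cyclic_iso[OF 2[unfolded kap]])
    show "phiO d (- c) a (- b) 1 = (- 1) * (2 * theta_seq a d 0 *
         (theta_seq b d d * (theta_seq a d 0 - theta_seq a d 1) + - phiO d (- a) b (- c) d) -
         kapO d a b c * (theta_seq a d 0 - theta_seq a d 1)) - theta_seq (- c) d 0 * (theta_seq a d 0 - theta_seq a d 1)"
      using d by (simp add: theta_seq_def phiO_def kapO_def field_simps power2_eq_square)
  qed (use sep in auto)
  moreover have "bm_twist (1, -1) cyc132 (O_mod d a b c)
      = \<lparr>bm_carrier = fin_space d, bm_X = \<lambda>v. vsc (- 1) (C v), bm_Y = L, bm_Z = \<lambda>v. vsc (- 1) (U v)\<rparr>"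
    by (simp add: O_mod_eq bm_twist_def Let_def cyc132_def bm_gen_def sign_of_def tri_module_def C_def[abs_def]
        vsc_def fin_space_def)
  ultimately show ?thesis by (simp add: O_mod_eq kap)
qed

section \<open>The Dunkl monogenics in coordinates\<close>

text \<open>Coefficients at \<open>x\<^sub>1 = 0\<close> of the two eigencomponents (\<open>s = 0, 1\<close>) of \<open>e\<^sub>3 R\<^sub>3\<close>, whose spinor index alternates
  with the exponent of \<open>x\<^sub>3\<close>.\<close>

definition x1_coeff :: "nat \<Rightarrow> cpoly \<Rightarrow> nat \<Rightarrow> nat \<Rightarrow> complex" where
  "x1_coeff n p s j = p (if even j then s else 1 - s, 0, n - j, j)"

lemma x1_coeff_Suc: "s < 2 \<Longrightarrow> x1_coeff n q s (Suc j) = q (1 - (if even j then s else 1 - s), 0, n - j - 1, Suc j)"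
  by (auto simp: x1_coeff_def)

lemma x1_coeff_pred:
  "s < 2 \<Longrightarrow> j \<le> n \<Longrightarrow> j \<noteq> 0 \<Longrightarrow>
    x1_coeff n q s (j - 1) = q (1 - (if even j then s else 1 - s), 0, Suc (n - j), j - 1)"
  by (cases j) (auto simp: x1_coeff_def Suc_diff_Suc)

text \<open>The generators shift the exponent of \<open>x_3\<close> by one exactly when they flip
  the spinor index. Along the alternating index \<open>s'\<close> the two values of \<open>s\<close>
  therefore decouple.\<close>

lemma x1_coeff_X:
  assumes p: "p \<in> Mn (kf k1 k2 k3) n" and n: "even n" and s: "s < 2" and j: "j \<le> n"
  shows "x1_coeff n (bm_X (M_module (kf k1 k2 k3) m) p) s j =
    (1 / 2 + (-1) ^ j * (of_real k2 + of_real k3)) * x1_coeff n p s j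
    + \<i> * (if j = 0 then 0 else dnum k2 (Suc (n - j)) * x1_coeff n p s (j - 1))
    - \<i> * (if j = n then 0 else dnum k3 (Suc j) * x1_coeff n p s (Suc j))"
proof -
  define s' where "s' = (if even j then s else 1 - s)"
  have s': "s' < 2" "\<And>q. x1_coeff n q s j = q (s', 0, n - j, j)"
    "\<And>q. x1_coeff n q s (Suc j) = q (1 - s', 0, n - j - 1, Suc j)"
    "\<And>q. j \<noteq> 0 \<Longrightarrow> x1_coeff n q s (j - 1) = q (1 - s', 0, Suc (n - j), j - 1)"
    using s x1_coeff_Suc[OF s] x1_coeff_pred[OF s j] by (auto simp: s'_def x1_coeff_def)
  have nj: "n - j + j = n" "n - j = 0 \<longleftrightarrow> j = n" using j by auto
  have pred: "(if j = 0 then 0 else dnum k2 (Suc (n - j)) * x1_coeff n p s (j - 1))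
      = (if j = 0 then 0 else dnum k2 (Suc (n - j)) * p (1 - s', 0, Suc (n - j), j - 1))"
    using s'(4) by simp
  show ?thesis
    using M_module_X_restr[of p k1 k2 k3 "n - j" j s' m, unfolded nj, OF p n s'(1)]
    unfolding pred s'(2,3) .
qed

lemma x1_coeff_Y:
  assumes p: "p \<in> Mn (kf k1 k2 k3) n" and s: "s < 2" and j: "j \<le> n"
  shows "x1_coeff n (bm_Y (M_module (kf k1 k2 k3) m) p) s j =
    (-1) ^ j * (of_nat j + of_real k1 + of_real k3 + 1 / 2) * x1_coeff n p s j
    - \<i> * (-1) ^ j * (if j = 0 then 0 else dnum k2 (Suc (n - j)) * x1_coeff n p s (j - 1))"
proof -
  define s' where "s' = (if even j then s else 1 - s)"
  have s': "s' < 2" "\<And>q. x1_coeff n q s j = q (s', 0, n - j, j)"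
    "\<And>q. x1_coeff n q s (Suc j) = q (1 - s', 0, n - j - 1, Suc j)"
    "\<And>q. j \<noteq> 0 \<Longrightarrow> x1_coeff n q s (j - 1) = q (1 - s', 0, Suc (n - j), j - 1)"
    using s x1_coeff_Suc[OF s] x1_coeff_pred[OF s j] by (auto simp: s'_def x1_coeff_def)
  have pred: "(if j = 0 then 0 else dnum k2 (Suc (n - j)) * x1_coeff n p s (j - 1))
      = (if j = 0 then 0 else dnum k2 (Suc (n - j)) * p (1 - s', 0, Suc (n - j), j - 1))"
    using s'(4) by simp
  show ?thesis
    using M_module_Y_restr[OF p s'(1), of m "n - j" j]
    unfolding pred s'(2,3) .
qed

lemma x1_coeff_Z:
  assumes p: "p \<in> Mn (kf k1 k2 k3) n" and n: "even n" and s: "s < 2" and j: "j \<le> n"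
  shows "x1_coeff n (bm_Z (M_module (kf k1 k2 k3) m) p) s j =
    (-1) ^ j * (of_nat n - of_nat j + of_real k1 + of_real k2 + 1 / 2) * x1_coeff n p s j
    + \<i> * (-1) ^ j * (if j = n then 0 else dnum k3 (Suc j) * x1_coeff n p s (Suc j))"
proof -
  define s' where "s' = (if even j then s else 1 - s)"
  have s': "s' < 2" "\<And>q. x1_coeff n q s j = q (s', 0, n - j, j)"
    "\<And>q. x1_coeff n q s (Suc j) = q (1 - s', 0, n - j - 1, Suc j)"
    "\<And>q. j \<noteq> 0 \<Longrightarrow> x1_coeff n q s (j - 1) = q (1 - s', 0, Suc (n - j), j - 1)"
    using s x1_coeff_Suc[OF s] x1_coeff_pred[OF s j] by (auto simp: s'_def x1_coeff_def)
  have par: "(-1::complex) ^ (n - j) = (-1) ^ j" using n j by (simp add: minus_one_power_iff)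
  have nj: "n - j = 0 \<longleftrightarrow> j = n" using j by auto
  show ?thesis
    using M_module_Z_restr[OF p s'(1), of m "n - j" j]
    unfolding par nj of_nat_diff[OF j] s'(2,3) .
qed

text \<open>Rescaling that turns the subdiagonal entries into ones; \<open>o'\<close> is the exponent of \<open>x\<^sub>3\<close> in the first basis vector.\<close>

definition scale :: "real \<Rightarrow> nat \<Rightarrow> nat \<Rightarrow> complex \<Rightarrow> nat \<Rightarrow> complex" where
  "scale k2 n o' \<epsilon> i = (\<Prod>m<i. \<epsilon> * \<i> * (-1) ^ (o' + Suc m) / dnum k2 (n - (o' + m)))"

definition restr_vec :: "real \<Rightarrow> nat \<Rightarrow> nat \<Rightarrow> nat \<Rightarrow> complex \<Rightarrow> nat \<Rightarrow> cpoly \<Rightarrow> nat \<Rightarrow> complex" where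
  "restr_vec k2 n o' d \<epsilon> s p i = (if i \<le> d then scale k2 n o' \<epsilon> i * x1_coeff n p s (o' + i) else 0)"

text \<open>The exponents \<open>o', ..., o' + d\<close> form a closed window: \<open>lo\<close>
  removes the coupling to the exponent below it and \<open>hi\<close> the one above it. Within the
  window the rescaled coefficients carry exactly the bidiagonal action.\<close>

lemma restr_vec_twist:
  fixes k1 k2 k3 :: real and \<epsilon> :: complex
  assumes arr: "bi_array d \<alpha> \<beta> \<phi> \<kappa> \<nu> \<mu>"
    and p: "p \<in> Mn (kf k1 k2 k3) n" and n: "even n" and s: "s < 2" and od: "o' + d \<le> n"
    and eps: "\<epsilon> * \<epsilon> = 1"
    and dn: "\<And>m. 1 \<le> m \<Longrightarrow> m \<le> n \<Longrightarrow> dnum k2 m \<noteq> 0"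
    and alpha: "\<And>i. \<alpha> i = \<epsilon> * (-1) ^ (o' + i) * (of_nat (o' + i) + of_real k1 + of_real k3 + 1 / 2)"
    and beta: "\<And>i. \<beta> i = - \<epsilon> * (-1) ^ (o' + i) * (of_nat n - of_nat (o' + i) + of_real k1 + of_real k2 + 1 / 2)"
    and phi: "\<And>i. i \<le> d \<Longrightarrow> \<phi> i = dnum k3 (o' + i) * dnum k2 (Suc (n - (o' + i)))"
    and kap: "\<kappa> = - 2 * of_real k1 * (of_real k1 + of_real k2 + of_real k3 + of_nat n + 1) - 2 * of_real k2 * of_real k3"
    and lo: "o' = 0 \<or> x1_coeff n p s (o' - 1) = 0"
    and hi: "o' + d = n \<or> dnum k3 (Suc (o' + d)) = 0"
  defines "v \<equiv> restr_vec k2 n o' d \<epsilon> s"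
  shows "v (bm_Y (M_module (kf k1 k2 k3) m) p) = vsc \<epsilon> (bd_lower d \<alpha> (v p))" (is ?Y)
    and "v (bm_Z (M_module (kf k1 k2 k3) m) p) = vsc (- \<epsilon>) (bd_upper d \<beta> \<phi> (v p))" (is ?Z)
    and "v (bm_X (M_module (kf k1 k2 k3) m) p) = vsc (- 1) (bm_Z (tri_module d \<alpha> \<beta> \<phi> \<kappa>) (v p))" (is ?X)
proof -
  interpret bi_array d \<alpha> \<beta> \<phi> \<kappa> \<nu> \<mu> by (rule arr)
  let ?q = "x1_coeff n p s"
  let ?l = "scale k2 n o' \<epsilon>"
  have ee: "\<epsilon> * (\<epsilon> * z) = z" for z using eps by (simp flip: mult.assoc)
  have vp: "v p i = (if i \<le> d then ?l i * ?q (o' + i) else 0)" for i by (simp add: v_def restr_vec_def)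
  have l_suc: "?l (Suc i) * dnum k2 (n - (o' + i)) = ?l i * (\<epsilon> * \<i> * (-1) ^ (o' + Suc i))" if "Suc i \<le> d" for i
    using dn[of "n - (o' + i)"] that od by (simp add: scale_def)
  have pm: "(-1::complex) ^ m * ((-1) ^ m * z) = z" for m z
    by (simp flip: mult.assoc power_add)
  \<comment> \<open>Inside the window \<open>l_suc\<close> trades the weight \<open>dnum k2\<close>
    for a sign, so the subdiagonal is normalised to one up to that sign.\<close>
  have down: "?l i * (\<i> * (if o' + i = 0 then 0 else dnum k2 (Suc (n - (o' + i))) * ?q (o' + i - 1)))
      = - \<epsilon> * (-1) ^ (o' + i) * (if i = 0 then 0 else v p (i - 1))" if i: "i \<le> d" for i
  proof (cases i)
    case 0
    then show ?thesis using lo by auto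
  next
    case (Suc e)
    then have "Suc (n - (o' + i)) = n - (o' + e)" using i od by auto
    then have "?l i * dnum k2 (Suc (n - (o' + i))) = ?l e * (\<epsilon> * \<i> * (-1) ^ (o' + i))"
      using l_suc[of e] i Suc by simp
    then have "?l i * dnum k2 (Suc (n - (o' + i))) * (\<i> * ?q (o' + e)) = ?l e * (\<epsilon> * \<i> * (-1) ^ (o' + i)) * (\<i> * ?q (o' + e))"
      by simp
    then have "?l i * (\<i> * (dnum k2 (Suc (n - (o' + i))) * ?q (o' + e))) = - \<epsilon> * (-1) ^ (o' + i) * (?l e * ?q (o' + e))"
      by (simp add: algebra_simps)
    then show ?thesis using Suc i by (simp add: vp)
  qed
  \<comment> \<open>The weight removed below reappears above the diagonal, which explains why
    \<open>\<phi>\<close> is a product of a \<open>dnum k3\<close> and a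
    \<open>dnum k2\<close>.\<close>
  have up: "?l i * (\<i> * (if o' + i = n then 0 else dnum k3 (Suc (o' + i)) * ?q (Suc (o' + i))))
      = - \<epsilon> * (-1) ^ (o' + i) * (\<phi> (Suc i) * v p (Suc i))" if i: "i \<le> d" for i
  proof (cases "i = d")
    case True
    then show ?thesis using hi psi_end by auto
  next
    case False
    then have i': "Suc i \<le> d" using i by simp
    then have nn: "Suc (n - (o' + Suc i)) = n - (o' + i)" "o' + i \<noteq> n" using od by auto
    have "\<phi> (Suc i) * v p (Suc i) = dnum k3 (Suc (o' + i)) * (?l (Suc i) * dnum k2 (n - (o' + i))) * ?q (Suc (o' + i))"
      using i' nn by (simp add: vp phi)
    also have "\<dots> = dnum k3 (Suc (o' + i)) * (?l i * (\<epsilon> * \<i> * (-1) ^ (o' + Suc i))) * ?q (Suc (o' + i))"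
      unfolding l_suc[OF i'] ..
    finally show ?thesis using nn by (simp add: ee pm algebra_simps)
  qed
  have C_row: "(1 / 2 + (-1) ^ (o' + i) * (of_real k2 + of_real k3)) * v p i
         - \<epsilon> * (-1) ^ (o' + i) * (if i = 0 then 0 else v p (i - 1)) + \<epsilon> * (-1) ^ (o' + i) * (\<phi> (Suc i) * v p (Suc i))
      = - (L (U (v p)) i + U (L (v p)) i - \<kappa> * v p i)" if i: "i \<le> d" for i
  proof -
    define J where "J = o' + i"
    define m where "m = n - J"
    have Jm: "n = J + m" using i od by (simp add: J_def m_def)
    have phi_i: "\<phi> i = dnum k3 J * dnum k2 (Suc m)" using phi[OF i] by (simp add: J_def m_def)
    \<comment> \<open>The product formula persists at \<open>i = d\<close>: by \<open>hi\<close>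
      either \<open>m = 0\<close>, so that \<open>dnum k2 m = 0\<close>, or
      \<open>dnum k3 (Suc J) = 0\<close>.\<close>
    have phi_s: "\<phi> (Suc i) = dnum k3 (Suc J) * dnum k2 m"
    proof (cases "i = d")
      case True
      then show ?thesis using hi psi_end by (auto simp: J_def m_def)
    next
      case False
      then have "Suc i \<le> d" "Suc (n - (o' + Suc i)) = n - (o' + i)" using i od by auto
      then show ?thesis using phi[of "Suc i"] by (simp add: J_def m_def)
    qed
    have par: "even m \<longleftrightarrow> even J" using n Jm by auto
    have a: "\<alpha> i = \<epsilon> * (-1) ^ J * (of_nat J + of_real k1 + of_real k3 + 1 / 2)"
      "\<alpha> (Suc i) = - \<epsilon> * (-1) ^ J * (of_nat J + 1 + of_real k1 + of_real k3 + 1 / 2)"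
      using alpha[of i] alpha[of "Suc i"] by (simp_all add: J_def algebra_simps)
    have b: "\<beta> i = - \<epsilon> * (-1) ^ J * (of_nat m + of_real k1 + of_real k2 + 1 / 2)"
      using beta[of i] Jm by (simp add: J_def)
    have ab: "\<alpha> i * \<beta> i = - ((of_nat J + of_real k1 + of_real k3 + 1 / 2) * (of_nat m + of_real k1 + of_real k2 + 1 / 2))"
      unfolding a b by (simp add: ee pm mult.assoc mult.left_commute)
    \<comment> \<open>\<open>X\<close> was computed directly, so it has to be compared with the
      anticommutator. On the diagonal this is the identity that fixes the value \<open>kap\<close>
      of \<open>\<kappa>\<close>.\<close>
    have diag: "2 * (\<alpha> i * \<beta> i) + \<phi> i + \<phi> (Suc i) - \<kappa> = - (1 / 2 + (-1) ^ J * (of_real k2 + of_real k3))"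
      unfolding ab phi_i phi_s kap Jm using par
      by (cases "even J") (simp_all add: dnum_parity algebra_simps add_divide_distrib)
    have super: "\<alpha> i + \<alpha> (Suc i) = - \<epsilon> * (-1) ^ J"
      unfolding a by (simp add: algebra_simps)
    have UL: "U (L (v p)) i = \<beta> i * L (v p) i + \<phi> (Suc i) * (\<alpha> (Suc i) * v p (Suc i) + v p i)"
      unfolding psi_L[OF i, symmetric] using i by (simp add: U_apply[of "L (v p)" i])
    have Ui: "U (v p) i = \<beta> i * v p i + \<phi> (Suc i) * v p (Suc i)" using i by (simp add: U_apply)
    have "L (U (v p)) i + U (L (v p)) i - \<kappa> * v p i = (2 * (\<alpha> i * \<beta> i) + \<phi> i + \<phi> (Suc i) - \<kappa>) * v p i
        + \<epsilon> * (-1) ^ J * (if i = 0 then 0 else v p (i - 1)) + (\<alpha> i + \<alpha> (Suc i)) * (\<phi> (Suc i) * v p (Suc i))"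
    proof (cases i)
      case 0
      have Li: "L w i = \<alpha> i * w i" for w using 0 by (simp add: L_apply)
      have "\<phi> i = 0" using 0 psi_0 by simp
      then show ?thesis unfolding UL Li Ui using 0 by (simp add: algebra_simps)
    next
      case (Suc e)
      have Li: "L w i = \<alpha> i * w i + w e" for w using Suc i by (simp add: L_apply)
      have Ue: "U (v p) e = \<beta> e * v p e + \<phi> i * v p i" using Suc i by (simp add: U_apply)
      have sub: "\<beta> e + \<beta> i = \<epsilon> * (-1) ^ J"
        unfolding Suc J_def beta by (simp add: algebra_simps)
      have "L (U (v p)) i + U (L (v p)) i - \<kappa> * v p i = (2 * (\<alpha> i * \<beta> i) + \<phi> i + \<phi> (Suc i) - \<kappa>) * v p i
        + (\<beta> e + \<beta> i) * v p e + (\<alpha> i + \<alpha> (Suc i)) * (\<phi> (Suc i) * v p (Suc i))"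
        unfolding Li UL Ue Ui by (simp add: algebra_simps)
      then show ?thesis unfolding sub using Suc by simp
    qed
    then show ?thesis unfolding diag super by (simp add: J_def algebra_simps)
  qed
  show ?Y
  proof
    fix i
    show "v (bm_Y (M_module (kf k1 k2 k3) m) p) i = vsc \<epsilon> (bd_lower d \<alpha> (v p)) i"
    proof (cases "i \<le> d")
      case True
      have j: "o' + i \<le> n" using True od by simp
      have "v (bm_Y (M_module (kf k1 k2 k3) m) p) i = (-1) ^ (o' + i) * (of_nat (o' + i) + of_real k1 + of_real k3 + 1 / 2) * v p i
         - (-1) ^ (o' + i) * (?l i * (\<i> * (if o' + i = 0 then 0 else dnum k2 (Suc (n - (o' + i))) * ?q (o' + i - 1))))"
        using True by (simp only: v_def restr_vec_def x1_coeff_Y[OF p s j] if_True) (simp only: algebra_simps)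
      also have "\<dots> = \<epsilon> * (\<alpha> i * v p i + (if i = 0 then 0 else v p (i - 1)))"
        unfolding down[OF True] alpha by (simp add: ee pm algebra_simps)
      finally show ?thesis using True by (simp add: L_apply vsc_def)
    qed (simp add: v_def restr_vec_def vsc_def L_apply)
  qed
  show ?Z
  proof
    fix i
    show "v (bm_Z (M_module (kf k1 k2 k3) m) p) i = vsc (- \<epsilon>) (bd_upper d \<beta> \<phi> (v p)) i"
    proof (cases "i \<le> d")
      case True
      have j: "o' + i \<le> n" using True od by simp
      have "v (bm_Z (M_module (kf k1 k2 k3) m) p) i = (-1) ^ (o' + i) * (of_nat n - of_nat (o' + i) + of_real k1 + of_real k2 + 1 / 2) * v p i
         + (-1) ^ (o' + i) * (?l i * (\<i> * (if o' + i = n then 0 else dnum k3 (Suc (o' + i)) * ?q (Suc (o' + i)))))"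
        using True by (simp only: v_def restr_vec_def x1_coeff_Z[OF p n s j] if_True) (simp only: algebra_simps)
      also have "\<dots> = - \<epsilon> * (\<beta> i * v p i + \<phi> (Suc i) * v p (Suc i))"
        unfolding up[OF True] beta by (simp add: ee pm algebra_simps)
      finally show ?thesis using True by (simp add: U_apply vsc_def)
    qed (simp add: v_def restr_vec_def vsc_def U_apply)
  qed
  show ?X
  proof
    fix i
    show "v (bm_X (M_module (kf k1 k2 k3) m) p) i = vsc (- 1) (bm_Z (tri_module d \<alpha> \<beta> \<phi> \<kappa>) (v p)) i"
    proof (cases "i \<le> d")
      case True
      have j: "o' + i \<le> n" using True od by simp
      have "v (bm_X (M_module (kf k1 k2 k3) m) p) i = (1 / 2 + (-1) ^ (o' + i) * (of_real k2 + of_real k3)) * v p i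
         + ?l i * (\<i> * (if o' + i = 0 then 0 else dnum k2 (Suc (n - (o' + i))) * ?q (o' + i - 1)))
         - ?l i * (\<i> * (if o' + i = n then 0 else dnum k3 (Suc (o' + i)) * ?q (Suc (o' + i))))"
        using True by (simp only: v_def restr_vec_def x1_coeff_X[OF p n s j] if_True) (simp only: algebra_simps)
      also have "\<dots> = (1 / 2 + (-1) ^ (o' + i) * (of_real k2 + of_real k3)) * v p i
         - \<epsilon> * (-1) ^ (o' + i) * (if i = 0 then 0 else v p (i - 1)) + \<epsilon> * (-1) ^ (o' + i) * (\<phi> (Suc i) * v p (Suc i))"
        unfolding down[OF True] up[OF True] by (simp add: algebra_simps)
      also have "\<dots> = - (L (U (v p)) i + U (L (v p)) i - \<kappa> * v p i)"
        using C_row[OF True] by simp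
      finally show ?thesis using True by (simp add: tri_module_def vsc_def)
    qed (simp add: v_def restr_vec_def vsc_def tri_module_def L_apply U_apply)
  qed
qed

section \<open>The parameter \<open>t_3\<close> and the submodule\<close>

lemma tpar_eq:
  assumes "odd m" "2 * k i = - real m"
  shows "tpar k i = enat m"
proof -
  have "(THE m::nat. odd m \<and> 2 * k i = - real m) = m" using assms by (intro the_equality) auto
  then show ?thesis using assms unfolding tpar_def by metis
qed

lemma tparD:
  assumes "tpar k i = enat t"
  shows "odd t" "2 * k i = - real t"
proof -
  obtain m where m: "odd m" "2 * k i = - real m"
    using assms unfolding tpar_def by (metis enat.distinct(2))
  then have "t = m" using assms tpar_eq[of m k i] by simp
  then show "odd t" "2 * k i = - real t" using m by simp_all
qed

lemma dnum_nonzero: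
  assumes "enat n < tpar k i" "1 \<le> m" "m \<le> n"
  shows "dnum (k i) m \<noteq> 0"
proof (cases "even m")
  case True
  then show ?thesis using assms by (simp add: dnum_parity)
next
  case False
  show ?thesis
  proof
    assume "dnum (k i) m = 0"
    then have "complex_of_real (real m + 2 * k i) = 0" using False by (simp add: dnum_parity)
    then have "2 * k i = - real m" unfolding of_real_eq_0_iff by linarith
    then have "tpar k i = enat m" using tpar_eq[OF False] by blast
    then show False using assms by simp
  qed
qed

lemma Mn_diff:
  assumes "p \<in> Mn (kf k1 k2 k3) n" "q \<in> Mn (kf k1 k2 k3) n"
  shows "(\<lambda>x. p x - q x) \<in> Mn (kf k1 k2 k3) n"
proof -
  have "(\<lambda>x. p x - q x) \<in> hom_space n"
    using assms unfolding Mn_def hom_space_def by (auto, metis+)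
  moreover have "dirac (kf k1 k2 k3) (\<lambda>x. p x - q x) = vzero"
    unfolding dirac_eq_0_iff
  proof (intro allI impI)
    fix s a b c :: nat
    assume "s < 2"
    note rec = Mn_rec[OF assms(1) this, of a b c] Mn_rec[OF assms(2) this, of a b c]
    show "dnum k1 (Suc a) * (p (s, Suc a, b, c) - q (s, Suc a, b, c)) = (- 1) ^ s *
       (dnum k3 (Suc c) * (p (1 - s, a, b, Suc c) - q (1 - s, a, b, Suc c)) -
        \<i> * dnum k2 (Suc b) * (p (s, a, Suc b, c) - q (s, a, Suc b, c)))"
      by (simp only: right_diff_distrib rec) (simp add: algebra_simps)
  qed
  ultimately show ?thesis by (simp add: Mn_def)
qed

lemma x1_coeff_eq_0_iff:
  "(\<forall>s<2. x1_coeff n p s j = 0) \<longleftrightarrow> (\<forall>s<2. p (s, 0, n - j, j) = 0)"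
proof -
  have "(\<forall>s<2. P s) \<longleftrightarrow> P 0 \<and> P 1" for P :: "nat \<Rightarrow> bool"
    by (auto elim: less_2_cases_nat)
  then show ?thesis by (auto simp: x1_coeff_def)
qed

text \<open>Because \<open>dnum k3 t = 0\<close>, \<open>Mn_vanish\<close> allows divisibility by
  \<open>x_3^t\<close> to be tested on the hyperplane \<open>x_1 = 0\<close>.\<close>

lemma Mn_x_iff:
  assumes p: "p \<in> Mn (kf k1 k2 k3) n"
    and dn: "\<And>m. 1 \<le> m \<Longrightarrow> m \<le> n \<Longrightarrow> dnum k1 m \<noteq> 0"
    and t: "tpar (kf k1 k2 k3) 3 = enat t" "dnum k3 t = 0" "t \<le> n"
  shows "p \<in> Mn_x (kf k1 k2 k3) n 3 \<longleftrightarrow> (\<forall>j<t. \<forall>s<2. x1_coeff n p s j = 0)"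
proof -
  have "p \<in> Mn_x (kf k1 k2 k3) n 3 \<longleftrightarrow> (\<forall>s a b c. c < t \<longrightarrow> p (s, a, b, c) = 0)"
    using p by (auto simp: Mn_x_def t expo_def not_le[symmetric])
  also have "\<dots> \<longleftrightarrow> (\<forall>j<t. \<forall>s<2. p (s, 0, n - j, j) = 0)"
    using Mn_vanish[OF p dn, of t] t by blast
  finally show ?thesis by (simp add: x1_coeff_eq_0_iff)
qed

lemma Mn_eq_0:
  assumes p: "p \<in> Mn (kf k1 k2 k3) n"
    and dn: "\<And>m. 1 \<le> m \<Longrightarrow> m \<le> n \<Longrightarrow> dnum k1 m \<noteq> 0"
    and z: "\<And>j s. j \<le> n \<Longrightarrow> s < 2 \<Longrightarrow> x1_coeff n p s j = 0"
  shows "p x = 0"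
proof -
  obtain s a b c where x: "x = (s, a, b, c)" by (cases x)
  have z0: "p (s, 0, n - j, j) = 0" if "s < 2" "j \<le> n" for s j
    using x1_coeff_eq_0_iff[of n p j] z that by blast
  have "p (s, a, b, c) = 0" if "c < Suc n"
    by (rule Mn_vanish[OF p dn _ z0 that]) auto
  moreover have "p (s, a, b, c) = 0" if "\<not> c < Suc n"
    using that by (intro Mn_support[OF p]) auto
  ultimately show ?thesis using x by blast
qed

section \<open>The two copies as a direct sum\<close>

lemma bm_dsum_simps:
  "bm_X (bm_dsum M N) (case_sum f g) = case_sum (bm_X M f) (bm_X N g)"
  "bm_Y (bm_dsum M N) (case_sum f g) = case_sum (bm_Y M f) (bm_Y N g)"
  "bm_Z (bm_dsum M N) (case_sum f g) = case_sum (bm_Z M f) (bm_Z N g)"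
  "case_sum f g \<in> bm_carrier (bm_dsum M N) \<longleftrightarrow> f \<in> bm_carrier M \<and> g \<in> bm_carrier N"
  by (auto simp: bm_dsum_def Let_def fun_eq_iff split: sum.split)

lemma bm_dsum_carrierE:
  assumes "w \<in> bm_carrier (bm_dsum M N)"
  obtains f g where "w = case_sum f g" "f \<in> bm_carrier M" "g \<in> bm_carrier N"
proof
  show "w = case_sum (\<lambda>i. w (Inl i)) (\<lambda>i. w (Inr i))" by (auto simp: fun_eq_iff split: sum.split)
qed (use assms in \<open>simp_all add: bm_dsum_def Let_def\<close>)

definition restr_pair :: "real \<Rightarrow> nat \<Rightarrow> nat \<Rightarrow> nat \<Rightarrow> complex \<Rightarrow> cpoly \<Rightarrow> nat + nat \<Rightarrow> complex" where
  "restr_pair k2 n o' d \<epsilon> p = case_sum (restr_vec k2 n o' d \<epsilon> 0 p) (restr_vec k2 n o' d \<epsilon> 1 p)"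

lemma scale_nonzero:
  assumes "\<And>m. 1 \<le> m \<Longrightarrow> m \<le> n \<Longrightarrow> dnum k2 m \<noteq> 0" "o' + i \<le> n" "\<epsilon> \<noteq> 0"
  shows "scale k2 n o' \<epsilon> i \<noteq> 0"
  using assms by (auto simp: scale_def)

lemma restr_pair_linear: "complex_linear_on S (restr_pair k2 n o' d \<epsilon>)"
  by (auto simp: complex_linear_on_def restr_pair_def restr_vec_def x1_coeff_def vadd_def vsc_def
      fun_eq_iff algebra_simps split: sum.split)

lemma restr_pair_eq_0_iff:
  assumes "\<And>m. 1 \<le> m \<Longrightarrow> m \<le> n \<Longrightarrow> dnum k2 m \<noteq> 0" "o' + d \<le> n" "\<epsilon> \<noteq> 0"
  shows "restr_pair k2 n o' d \<epsilon> p = vzero \<longleftrightarrow> (\<forall>i\<le>d. \<forall>s<2. x1_coeff n p s (o' + i) = 0)"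
proof -
  have nz: "scale k2 n o' \<epsilon> i \<noteq> 0" if "i \<le> d" for i
    using assms that by (intro scale_nonzero) auto
  have "restr_pair k2 n o' d \<epsilon> p = vzero
      \<longleftrightarrow> (\<forall>i\<le>d. x1_coeff n p 0 (o' + i) = 0 \<and> x1_coeff n p 1 (o' + i) = 0)"
    using nz by (force simp: restr_pair_def restr_vec_def vzero_def fun_eq_iff split: sum.split)
  also have "\<dots> \<longleftrightarrow> (\<forall>i\<le>d. \<forall>s<2. x1_coeff n p s (o' + i) = 0)"
    by (auto elim!: less_2_cases_nat)
  finally show ?thesis .
qed

text \<open>\<open>ck_extension\<close> realises any boundary coefficients. Choosing zero below the
  window makes the preimage lie in the submodule when the window starts at
  \<open>t_3\<close>.\<close>

lemma restr_pair_surj: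
  assumes dn1: "\<And>m. 1 \<le> m \<Longrightarrow> m \<le> n \<Longrightarrow> dnum k1 m \<noteq> 0"
    and dn2: "\<And>m. 1 \<le> m \<Longrightarrow> m \<le> n \<Longrightarrow> dnum k2 m \<noteq> 0"
    and od: "o' + d \<le> n" and eps: "\<epsilon> \<noteq> 0"
    and w: "f \<in> fin_space d" "g \<in> fin_space d"
  shows "\<exists>p\<in>Mn (kf k1 k2 k3) n. restr_pair k2 n o' d \<epsilon> p = case_sum f g
    \<and> (\<forall>j<o'. \<forall>s<2. x1_coeff n p s j = 0)"
proof -
  define h where "h s = (if s = (0::nat) then f else g)" for s
  \<comment> \<open>Undoes the rescaling and the alternation of the spinor index; beyond the window
    \<open>f\<close> and \<open>g\<close> vanish.\<close>
  define w' where "w' s j = (if j < o' then 0 else h (if even j then s else 1 - s) (j - o') / scale k2 n o' \<epsilon> (j - o'))"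
    for s j
  obtain p where p: "p \<in> Mn (kf k1 k2 k3) n" "\<And>s j. s < 2 \<Longrightarrow> j \<le> n \<Longrightarrow> p (s, 0, n - j, j) = w' s j"
    using ck_extension[OF dn1, of n k2 k3 w'] by blast
  have nz: "scale k2 n o' \<epsilon> i \<noteq> 0" if "i \<le> d" for i
    using dn2 od eps that by (intro scale_nonzero) auto
  have x: "x1_coeff n p s j = (if j < o' then 0 else h s (j - o') / scale k2 n o' \<epsilon> (j - o'))" if "s < 2" "j \<le> n" for s j
    using that p(2)[of s j] p(2)[of "1 - s" j] by (auto simp: x1_coeff_def w'_def)
  have "restr_vec k2 n o' d \<epsilon> s p = h s" if "s < 2" for s
  proof
    fix i
    show "restr_vec k2 n o' d \<epsilon> s p i = h s i"
      using x[OF that, of "o' + i"] od nz[of i] w by (auto simp: restr_vec_def h_def fin_space_def)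
  qed
  from this[of 0] this[of 1] have "restr_pair k2 n o' d \<epsilon> p = case_sum f g"
    by (simp add: restr_pair_def h_def)
  then show ?thesis using p(1) x od by (intro bexI[of _ p]) auto
qed

text \<open>The sign \<open>e\<close> treats both twists \<open>(-1, 1)\<close> and
  \<open>(1, -1)\<close> at once: \<open>X\<close> always gets the sign \<open>- 1\<close>. The set
  \<open>S\<close> is the submodule in one application and all of \<open>Mn\<close> in the
  other.\<close>

lemma restr_pair_intertwines:
  fixes k1 k2 k3 :: real and e :: int
  assumes arr: "bi_array d \<alpha> \<beta> \<phi> \<kappa> \<nu> \<mu>"
    and n: "even n" and od: "o' + d \<le> n"
    and e: "e * e = 1"
    and dn: "\<And>m. 1 \<le> m \<Longrightarrow> m \<le> n \<Longrightarrow> dnum k2 m \<noteq> 0"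
    and alpha: "\<And>i. \<alpha> i = of_int e * (-1) ^ (o' + i) * (of_nat (o' + i) + of_real k1 + of_real k3 + 1 / 2)"
    and beta: "\<And>i. \<beta> i = - of_int e * (-1) ^ (o' + i) * (of_nat n - of_nat (o' + i) + of_real k1 + of_real k2 + 1 / 2)"
    and phi: "\<And>i. i \<le> d \<Longrightarrow> \<phi> i = dnum k3 (o' + i) * dnum k2 (Suc (n - (o' + i)))"
    and kap: "\<kappa> = - 2 * of_real k1 * (of_real k1 + of_real k2 + of_real k3 + of_nat n + 1) - 2 * of_real k2 * of_real k3"
    and hi: "o' + d = n \<or> dnum k3 (Suc (o' + d)) = 0"
    and S: "S \<subseteq> Mn (kf k1 k2 k3) n"
    and lo: "\<And>p s. p \<in> S \<Longrightarrow> s < 2 \<Longrightarrow> o' = 0 \<or> x1_coeff n p s (o' - 1) = 0"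
  defines "W \<equiv> bm_twist (e, - e) cyc132 (tri_module d \<alpha> \<beta> \<phi> \<kappa>)"
  shows "intertwines (bm_restrict (M_module (kf k1 k2 k3) n) S) (bm_dsum W W) (restr_pair k2 n o' d (of_int e))"
proof -
  have ee: "complex_of_int e * of_int e = 1" using e by (simp flip: of_int_mult)
  have W: "bm_X W u = vsc (- 1) (bm_Z (tri_module d \<alpha> \<beta> \<phi> \<kappa>) u)"
    "bm_Y W u = vsc (of_int e) (bd_lower d \<alpha> u)" "bm_Z W u = vsc (- of_int e) (bd_upper d \<beta> \<phi> u)" for u
    using ee by (simp_all add: W_def bm_twist_def Let_def cyc132_def bm_gen_def sign_of_def tri_module_def)
  show ?thesis
    unfolding intertwines_def
  proof
    fix p
    assume "p \<in> bm_carrier (bm_restrict (M_module (kf k1 k2 k3) n) S)"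
    then have p: "p \<in> S" "p \<in> Mn (kf k1 k2 k3) n" using S by (auto simp: bm_restrict_def)
    note tw = restr_vec_twist[OF arr p(2) n _ od ee dn alpha beta phi kap lo[OF p(1)] hi, where m = n]
    show "restr_pair k2 n o' d (of_int e) (bm_X (bm_restrict (M_module (kf k1 k2 k3) n) S) p)
          = bm_X (bm_dsum W W) (restr_pair k2 n o' d (of_int e) p)
        \<and> restr_pair k2 n o' d (of_int e) (bm_Y (bm_restrict (M_module (kf k1 k2 k3) n) S) p)
          = bm_Y (bm_dsum W W) (restr_pair k2 n o' d (of_int e) p)
        \<and> restr_pair k2 n o' d (of_int e) (bm_Z (bm_restrict (M_module (kf k1 k2 k3) n) S) p)
          = bm_Z (bm_dsum W W) (restr_pair k2 n o' d (of_int e) p)"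
      by (simp add: restr_pair_def bm_dsum_simps bm_restrict_def W tw)
  qed
qed

section \<open>Nonvanishing for real parameters\<close>

text \<open>The conditions range over real \<open>x\<close>, so they can be settled by linear
  inequalities. Two of them serve the array for \<open>a\<close>, the other two the opposite array
  for \<open>- a\<close>.\<close>

lemma bi_pair_E_real:
  fixes a b c :: real
  assumes d: "odd d"
    and nz: "\<And>x. 1 \<le> x \<Longrightarrow> x \<le> real d \<Longrightarrow>
      2 * c \<noteq> 2 * a + 2 * b - real d + 2 * x - 1 \<and> 2 * c \<noteq> - (2 * a + 2 * b - real d + 2 * x - 1) \<and>
      2 * c \<noteq> - 2 * a + 2 * b - real d + 2 * x - 1 \<and> 2 * c \<noteq> - (- 2 * a + 2 * b - real d + 2 * x - 1)"
  shows "bi_pair d (theta_seq (of_real a) d) (theta_seq (of_real b) d) (phiE d (of_real a) (of_real b) (of_real c))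
    (kapE d (of_real a) (of_real b) (of_real c)) (kapE d (of_real b) (of_real c) (of_real a))
    (kapE d (of_real c) (of_real a) (of_real b)) (theta_seq (- of_real a) d) (phiE d (- of_real a) (of_real b) (of_real c))"
proof (rule bi_pair_E[OF d])
  fix i :: nat
  assume i: "1 \<le> i" "i \<le> d"
  then have nz_i: "2 * c \<noteq> 2 * a + 2 * b - real d + 2 * real i - 1 \<and> 2 * c \<noteq> - (2 * a + 2 * b - real d + 2 * real i - 1) \<and>
      2 * c \<noteq> - 2 * a + 2 * b - real d + 2 * real i - 1 \<and> 2 * c \<noteq> - (- 2 * a + 2 * b - real d + 2 * real i - 1)"
    by (intro nz) simp_all
  show "phiE d (of_real a) (of_real b) (of_real c) i \<noteq> 0"
    using nz_i by (intro phiE_nonzero i) simp_all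
  have "phiE d (of_real (- a)) (of_real b) (of_real c) i \<noteq> 0"
    using nz_i by (intro phiE_nonzero i) simp_all
  then show "phiE d (- of_real a) (of_real b) (of_real c) i \<noteq> 0" by simp
qed

lemma bi_pair_O_real:
  fixes a b c :: real
  assumes d: "even d"
    and nz: "\<And>x. 1 \<le> x \<Longrightarrow> x \<le> real d \<Longrightarrow>
      real d + 1 - 2 * x - 2 * a - 2 * b - 2 * c \<noteq> 0 \<and> real d + 1 - 2 * x - 2 * a - 2 * b + 2 * c \<noteq> 0 \<and>
      real d + 1 - 2 * x + 2 * a - 2 * b + 2 * c \<noteq> 0 \<and> real d + 1 - 2 * x + 2 * a - 2 * b - 2 * c \<noteq> 0"
  shows "bi_pair d (theta_seq (of_real a) d) (theta_seq (of_real b) d) (phiO d (of_real a) (of_real b) (of_real c))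
    (kapO d (of_real a) (of_real b) (of_real c)) (kapO d (of_real b) (of_real c) (of_real a))
    (kapO d (of_real c) (of_real a) (of_real b)) (\<lambda>i. - theta_seq (- of_real a) d i)
    (\<lambda>i. - phiO d (- of_real a) (of_real b) (- of_real c) i)"
proof (rule bi_pair_O[OF d])
  fix i :: nat
  assume i: "1 \<le> i" "i \<le> d"
  then have nz_i: "real d + 1 - 2 * real i - 2 * a - 2 * b - 2 * c \<noteq> 0 \<and> real d + 1 - 2 * real i - 2 * a - 2 * b + 2 * c \<noteq> 0 \<and>
      real d + 1 - 2 * real i + 2 * a - 2 * b + 2 * c \<noteq> 0 \<and> real d + 1 - 2 * real i + 2 * a - 2 * b - 2 * c \<noteq> 0"
    by (intro nz) simp_all
  show "phiO d (of_real a) (of_real b) (of_real c) i \<noteq> 0"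
    using nz_i by (intro phiO_nonzero i) simp_all
  have "phiO d (of_real (- a)) (of_real b) (of_real (- c)) i \<noteq> 0"
    using nz_i by (intro phiO_nonzero i) simp_all
  then show "phiO d (- of_real a) (of_real b) (- of_real c) i \<noteq> 0" by simp
qed

theorem theorem7p7:
  fixes k1 k2 k3 :: real and n t3 :: nat
  defines "k \<equiv> kf k1 k2 k3"
  defines "K \<equiv> k1 + k2 + k3"
  defines "W1 \<equiv> bm_twist (-1, 1) cyc132
              (E_mod (n - t3) (of_real (k1 + (real n + 1) / 2)) (of_real (- K - (real n + 1) / 2))
                              (of_real (- k2 - (real n + 1) / 2)))"
  defines "W2 \<equiv> bm_twist (1, -1) cyc132
              (O_mod (t3 - 1) (of_real k1) (of_real (- K - real n - 1)) (of_real (- k2)))"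
  assumes "even n"
    and "tpar k 3 = enat t3"
    and "t3 \<le> n"
    and "enat n < tpar k 1" and "enat n < tpar k 2"
  shows "bimod_iso (bm_restrict (M_module k n) (Mn_x k n 3)) (bm_dsum W1 W1)
       \<and> bimod_quot_iso (M_module k n) (Mn_x k n 3) (bm_dsum W2 W2)
       \<and> (k1 \<ge> 0 \<and> k2 \<ge> 0 \<longrightarrow>
            bimod_irreducible W1 \<and> bimod_irreducible W2
          \<and> bimod_iso W1 (bm_twist (-1, -1) id
              (E_mod (n - t3) (of_real (k2 + (real n + 1) / 2)) (of_real (k1 + (real n + 1) / 2))
                              (of_real (K + (real n + 1) / 2))))
          \<and> bimod_iso W2 (O_mod (t3 - 1) (of_real k2) (of_real k1) (of_real (K + real n + 1))))"
proof (intro conjI impI)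
  have t3: "odd t3" "2 * k3 = - real t3"
    using tparD[OF assms(6)] by (simp_all add: k_def)
  have k3: "k3 = - real t3 / 2" using t3 by simp
  have dn1: "dnum k1 m \<noteq> 0" and dn2: "dnum k2 m \<noteq> 0" if "1 \<le> m" "m \<le> n" for m
    using dnum_nonzero[OF assms(8) that] dnum_nonzero[OF assms(9) that] by (simp_all add: k_def)
  have dt: "dnum k3 t3 = 0" using t3(1) by (simp add: dnum_parity k3)
  have t: "tpar (kf k1 k2 k3) 3 = enat t3" using assms(6) by (simp add: k_def)
  have t_pos: "1 \<le> t3" using t3(1) by (cases t3) auto
  have M: "bm_restrict (M_module k n) (Mn k n) = M_module k n" "bm_carrier (M_module k n) = Mn k n"
    by (simp_all add: bm_restrict_def M_module_def)
  have sub: "Mn_x k n 3 \<subseteq> Mn k n" by (auto simp: Mn_x_def)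
  \<comment> \<open>The exponents \<open>t3, ..., n\<close> of \<open>x_3\<close> give the submodule
    and \<open>0, ..., t3 - 1\<close> the quotient. As \<open>n\<close> is even and
    \<open>t3\<close> odd, \<open>d1\<close> is odd and \<open>d2\<close> even, which selects
    \<open>E\<close> and \<open>O\<close>.\<close>
  define d1 where "d1 = n - t3"
  define d2 where "d2 = t3 - 1"
  have d1: "odd d1" "real d1 = real n - real t3" "complex_of_nat d1 = of_nat n - of_nat t3" "t3 + d1 = n"
    using assms(5,7) t3(1) by (simp_all add: d1_def of_nat_diff)
  have d2: "even d2" "real d2 = real t3 - 1" "complex_of_nat d2 = of_nat t3 - 1" "Suc d2 = t3"
    using t3(1) t_pos by (simp_all add: d2_def of_nat_diff)
  define a1 b1 c1 where "a1 = k1 + (real n + 1) / 2" and "b1 = - K - (real n + 1) / 2" and "c1 = - k2 - (real n + 1) / 2"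
  define a2 b2 c2 where "a2 = k1" and "b2 = - K - real n - 1" and "c2 = - k2"
  note par1 = a1_def b1_def c1_def and par2 = a2_def b2_def c2_def
  have W1: "W1 = bm_twist (-1, - (-1)) cyc132 (tri_module d1 (theta_seq (of_real a1) d1) (theta_seq (of_real b1) d1)
      (phiE d1 (of_real a1) (of_real b1) (of_real c1)) (kapE d1 (of_real a1) (of_real b1) (of_real c1)))"
    by (simp add: W1_def E_mod_eq par1 flip: d1_def)
  have W2: "W2 = bm_twist (1, -1) cyc132 (tri_module d2 (theta_seq (of_real a2) d2) (theta_seq (of_real b2) d2)
      (phiO d2 (of_real a2) (of_real b2) (of_real c2)) (kapO d2 (of_real a2) (of_real b2) (of_real c2)))"
    unfolding W2_def O_mod_eq par2 d2_def by (rule refl)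
  have car1: "case_sum f g \<in> bm_carrier (bm_dsum W1 W1) \<longleftrightarrow> f \<in> fin_space d1 \<and> g \<in> fin_space d1" for f g
    by (simp add: bm_dsum_simps W1 bm_twist_def Let_def fin_space_carrier)
  have car2: "case_sum f g \<in> bm_carrier (bm_dsum W2 W2) \<longleftrightarrow> f \<in> fin_space d2 \<and> g \<in> fin_space d2" for f g
    by (simp add: bm_dsum_simps W2 bm_twist_def Let_def fin_space_carrier)
  have x_iff: "p \<in> Mn_x k n 3 \<longleftrightarrow> (\<forall>j<t3. \<forall>s<2. x1_coeff n p s j = 0)" if "p \<in> Mn k n" for p
    using Mn_x_iff[of p k1 k2 k3 n t3] that dn1 dt t assms(7) by (simp add: k_def)
  have into: "restr_pair k2 n o' d e p \<in> bm_carrier (bm_dsum W W)"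
    if "\<And>f g. case_sum f g \<in> bm_carrier (bm_dsum W W) \<longleftrightarrow> f \<in> fin_space d \<and> g \<in> fin_space d" for o' d e p W
    by (simp add: restr_pair_def that fin_space_def restr_vec_def)

  show "bimod_iso (bm_restrict (M_module k n) (Mn_x k n 3)) (bm_dsum W1 W1)"
    unfolding bimod_iso_def
  \<comment> \<open>The window starts at \<open>t3\<close>, below which coefficients vanish on the
    submodule, and ends at \<open>n\<close>. The sign \<open>- 1\<close> compensates
    \<open>(-1) ^ t3\<close>.\<close>
  proof (intro exI[of _ "restr_pair k2 n t3 d1 (of_int (- 1))"] conjI)
    let ?R = "restr_pair k2 n t3 d1 (of_int (- 1))"
    show "complex_linear_on (bm_carrier (bm_restrict (M_module k n) (Mn_x k n 3))) ?R"
      by (rule restr_pair_linear)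
    show "intertwines (bm_restrict (M_module k n) (Mn_x k n 3)) (bm_dsum W1 W1) ?R"
      unfolding W1 k_def
    proof (rule restr_pair_intertwines[OF bi_array_E[OF d1(1)] assms(5) _ _ dn2])
      show "Mn_x (kf k1 k2 k3) n 3 \<subseteq> Mn (kf k1 k2 k3) n" using sub by (simp add: k_def)
      show "theta_seq (of_real a1) d1 i = of_int (- 1) * (- 1) ^ (t3 + i) * (of_nat (t3 + i) + of_real k1 + of_real k3 + 1 / 2)" for i
        using t3(1) by (simp add: theta_seq_def d1 par1 k3 power_add field_simps)
      show "theta_seq (of_real b1) d1 i = - of_int (- 1) * (- 1) ^ (t3 + i) * (of_nat n - of_nat (t3 + i) + of_real k1 + of_real k2 + 1 / 2)" for i
        using t3(1) by (simp add: theta_seq_def d1 par1 K_def k3 power_add field_simps)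
      show "phiE d1 (of_real a1) (of_real b1) (of_real c1) i = dnum k3 (t3 + i) * dnum k2 (Suc (n - (t3 + i)))" if "i \<le> d1" for i
      proof -
        have m: "n - (t3 + i) = d1 - i" "complex_of_nat (d1 - i) = of_nat n - of_nat t3 - of_nat i" "even (d1 - i) \<longleftrightarrow> odd i"
          using that d1 by (simp_all add: of_nat_diff)
        show ?thesis
          unfolding m(1) using t3(1) d1(1) that
          by (cases "even i") (simp_all add: m(2,3) dnum_parity phiE_def d1 par1 K_def k3 field_simps power2_eq_square)
      qed
      show "kapE d1 (of_real a1) (of_real b1) (of_real c1)
          = - 2 * of_real k1 * (of_real k1 + of_real k2 + of_real k3 + of_nat n + 1) - 2 * of_real k2 * of_real k3"
        by (simp add: kapE_def d1 par1 K_def k3 field_simps power2_eq_square)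
      show "t3 = 0 \<or> x1_coeff n p s (t3 - 1) = 0" if "p \<in> Mn_x (kf k1 k2 k3) n 3" "s < 2" for p s
        using that x_iff[of p] sub t_pos by (auto simp: k_def)
    qed (use d1(4) in simp_all)
    show "bij_betw ?R (bm_carrier (bm_restrict (M_module k n) (Mn_x k n 3))) (bm_carrier (bm_dsum W1 W1))"
      unfolding bij_betw_def
    proof
      show "inj_on ?R (bm_carrier (bm_restrict (M_module k n) (Mn_x k n 3)))"
      proof (rule inj_onI)
        fix p q
        assume "p \<in> bm_carrier (bm_restrict (M_module k n) (Mn_x k n 3))"
          "q \<in> bm_carrier (bm_restrict (M_module k n) (Mn_x k n 3))" and eq: "?R p = ?R q"
        then have p: "p \<in> Mn_x k n 3" "p \<in> Mn k n" and q: "q \<in> Mn_x k n 3" "q \<in> Mn k n"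
          using sub by (auto simp: bm_restrict_def)
        let ?r = "\<lambda>x. p x - q x"
        have r: "?r \<in> Mn (kf k1 k2 k3) n" using Mn_diff p(2) q(2) by (simp add: k_def)
        have diff: "x1_coeff n ?r s j = x1_coeff n p s j - x1_coeff n q s j" for s j by (simp add: x1_coeff_def)
        have "?R ?r = vzero"
          using eq by (auto simp: restr_pair_def restr_vec_def diff vzero_def fun_eq_iff algebra_simps split: sum.splits if_splits)
        then have hi: "x1_coeff n ?r s (t3 + i) = 0" if "i \<le> d1" "s < 2" for s i
          using restr_pair_eq_0_iff[of n k2 t3 d1 "of_int (- 1)" ?r] dn2 d1(4) that by simp
        have "x1_coeff n ?r s j = 0" if "j \<le> n" "s < 2" for s j
        proof (cases "j < t3")
          case True
          then show ?thesis using x_iff[OF p(2)] x_iff[OF q(2)] p(1) q(1) that by (simp add: diff)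
        next
          case False
          then show ?thesis using hi[of "j - t3" s] d1(4) that by simp
        qed
        then have "?r x = 0" for x using Mn_eq_0[OF r dn1] by blast
        then show "p = q" by (simp add: fun_eq_iff)
      qed
      show "?R ` bm_carrier (bm_restrict (M_module k n) (Mn_x k n 3)) = bm_carrier (bm_dsum W1 W1)"
      proof
        show "?R ` bm_carrier (bm_restrict (M_module k n) (Mn_x k n 3)) \<subseteq> bm_carrier (bm_dsum W1 W1)"
          using into[OF car1] by blast
        show "bm_carrier (bm_dsum W1 W1) \<subseteq> ?R ` bm_carrier (bm_restrict (M_module k n) (Mn_x k n 3))"
        proof
          fix w
          assume w: "w \<in> bm_carrier (bm_dsum W1 W1)"
          then obtain f g where fg: "w = case_sum f g" by (rule bm_dsum_carrierE)
          then have "f \<in> fin_space d1" "g \<in> fin_space d1" using w car1 by simp_all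
          then have "\<exists>p\<in>Mn (kf k1 k2 k3) n. ?R p = case_sum f g \<and> (\<forall>j<t3. \<forall>s<2. x1_coeff n p s j = 0)"
            using d1(4) by (intro restr_pair_surj dn1 dn2) simp_all
          then obtain p where "p \<in> Mn (kf k1 k2 k3) n" "?R p = w" "\<forall>j<t3. \<forall>s<2. x1_coeff n p s j = 0"
            using fg by blast
          then show "w \<in> ?R ` bm_carrier (bm_restrict (M_module k n) (Mn_x k n 3))"
            using x_iff[of p] by (auto simp: bm_restrict_def k_def)
        qed
      qed
    qed
  qed

  show "bimod_quot_iso (M_module k n) (Mn_x k n 3) (bm_dsum W2 W2)"
    unfolding bimod_quot_iso_def
  \<comment> \<open>The window starts at exponent \<open>0\<close> and is cut off above by
    \<open>dnum k3 t3 = 0\<close>; the kernel of the coordinate map is the submodule by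
    \<open>x_iff\<close>.\<close>
  proof (intro exI[of _ "restr_pair k2 n 0 d2 (of_int 1)"] conjI ballI)
    let ?R = "restr_pair k2 n 0 d2 (of_int 1)"
    have dn: "0 + d2 \<le> n" using d2(4) assms(7) by simp
    show "complex_linear_on (bm_carrier (M_module k n)) ?R"
      by (rule restr_pair_linear)
    have "intertwines (bm_restrict (M_module k n) (Mn k n)) (bm_dsum W2 W2) ?R"
      unfolding W2 k_def
    proof (rule restr_pair_intertwines[OF bi_array_O[OF d2(1)] assms(5) dn _ dn2])
      show "theta_seq (of_real a2) d2 i = of_int 1 * (- 1) ^ (0 + i) * (of_nat (0 + i) + of_real k1 + of_real k3 + 1 / 2)" for i
        by (simp add: theta_seq_def d2 par2 k3 field_simps)
      show "theta_seq (of_real b2) d2 i = - of_int 1 * (- 1) ^ (0 + i) * (of_nat n - of_nat (0 + i) + of_real k1 + of_real k2 + 1 / 2)" for i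
        by (simp add: theta_seq_def d2 par2 K_def k3 field_simps)
      show "phiO d2 (of_real a2) (of_real b2) (of_real c2) i = dnum k3 (0 + i) * dnum k2 (Suc (n - (0 + i)))" if "i \<le> d2" for i
      proof -
        have m: "complex_of_nat (n - i) = of_nat n - of_nat i" "even (n - i) \<longleftrightarrow> even i"
          using that dn assms(5) by (simp_all add: of_nat_diff)
        show ?thesis
          unfolding add_0 using that dn assms(5)
          by (cases "even i") (simp_all add: m dnum_parity phiO_def d2 par2 K_def k3 field_simps power2_eq_square)
      qed
      show "kapO d2 (of_real a2) (of_real b2) (of_real c2)
          = - 2 * of_real k1 * (of_real k1 + of_real k2 + of_real k3 + of_nat n + 1) - 2 * of_real k2 * of_real k3"
        by (simp add: kapO_def d2 par2 K_def k3 field_simps power2_eq_square)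
      show "0 + d2 = n \<or> dnum k3 (Suc (0 + d2)) = 0" using dt d2(4) by simp
    qed simp_all
    then show "intertwines (M_module k n) (bm_dsum W2 W2) ?R" unfolding M .
    show "?R ` bm_carrier (M_module k n) = bm_carrier (bm_dsum W2 W2)"
    proof
      show "?R ` bm_carrier (M_module k n) \<subseteq> bm_carrier (bm_dsum W2 W2)"
        using into[OF car2] by blast
      show "bm_carrier (bm_dsum W2 W2) \<subseteq> ?R ` bm_carrier (M_module k n)"
      proof
        fix w
        assume w: "w \<in> bm_carrier (bm_dsum W2 W2)"
        then obtain f g where fg: "w = case_sum f g" by (rule bm_dsum_carrierE)
        then have "f \<in> fin_space d2" "g \<in> fin_space d2" using w car2 by simp_all
        then have "\<exists>p\<in>Mn (kf k1 k2 k3) n. ?R p = case_sum f g \<and> (\<forall>j<0. \<forall>s<2. x1_coeff n p s j = 0)"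
          using dn by (intro restr_pair_surj dn1 dn2) simp_all
        then obtain p where "p \<in> Mn (kf k1 k2 k3) n" "?R p = w"
          using fg by blast
        then show "w \<in> ?R ` bm_carrier (M_module k n)"
          unfolding M(2) unfolding k_def by blast
      qed
    qed
    fix p
    assume "p \<in> bm_carrier (M_module k n)"
    then have p: "p \<in> Mn k n" by (simp add: M)
    have "i \<le> d2 \<longleftrightarrow> i < t3" for i using d2(4) by auto
    then show "?R p = vzero \<longleftrightarrow> p \<in> Mn_x k n 3"
      using restr_pair_eq_0_iff[OF dn2 dn, of "of_int 1" p] x_iff[OF p] by simp
  qed

  assume "k1 \<ge> 0 \<and> k2 \<ge> 0"
  then have k_nonneg: "0 \<le> k1" "0 \<le> k2" by simp_all
  \<comment> \<open>With \<open>k3 = - t3 / 2\<close> and \<open>k1\<close>, \<open>k2\<close>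
    nonnegative, each expression required to be nonzero has a strict sign for
    \<open>1 \<le> x \<le> d1\<close>. The next three facts follow in the same way, with
    \<open>d2\<close> for \<open>O\<close>.\<close>
  have E1: "bi_pair d1 (theta_seq (of_real a1) d1) (theta_seq (of_real b1) d1) (phiE d1 (of_real a1) (of_real b1) (of_real c1))
    (kapE d1 (of_real a1) (of_real b1) (of_real c1)) (kapE d1 (of_real b1) (of_real c1) (of_real a1))
    (kapE d1 (of_real c1) (of_real a1) (of_real b1)) (theta_seq (- of_real a1) d1) (phiE d1 (- of_real a1) (of_real b1) (of_real c1))"
    using k_nonneg t_pos unfolding par1 K_def k3
    by (intro bi_pair_E_real[OF d1(1)] conjI notI) (simp_all add: d1(2) field_simps)
  have E2: "bi_pair d1 (theta_seq (of_real (- c1)) d1) (theta_seq (of_real a1) d1) (phiE d1 (of_real (- c1)) (of_real a1) (of_real (- b1)))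
    (kapE d1 (of_real (- c1)) (of_real a1) (of_real (- b1))) (kapE d1 (of_real a1) (of_real (- b1)) (of_real (- c1)))
    (kapE d1 (of_real (- b1)) (of_real (- c1)) (of_real a1)) (theta_seq (- of_real (- c1)) d1) (phiE d1 (- of_real (- c1)) (of_real a1) (of_real (- b1)))"
    using k_nonneg t_pos unfolding par1 K_def k3
    by (intro bi_pair_E_real[OF d1(1)] conjI notI) (simp_all add: d1(2) field_simps)
  have O1: "bi_pair d2 (theta_seq (of_real a2) d2) (theta_seq (of_real b2) d2) (phiO d2 (of_real a2) (of_real b2) (of_real c2))
    (kapO d2 (of_real a2) (of_real b2) (of_real c2)) (kapO d2 (of_real b2) (of_real c2) (of_real a2))
    (kapO d2 (of_real c2) (of_real a2) (of_real b2)) (\<lambda>i. - theta_seq (- of_real a2) d2 i)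
    (\<lambda>i. - phiO d2 (- of_real a2) (of_real b2) (- of_real c2) i)"
    using k_nonneg assms(7) unfolding par2 K_def k3
    by (intro bi_pair_O_real[OF d2(1)] conjI notI) (simp_all add: d2(2) field_simps)
  have O2: "bi_pair d2 (theta_seq (of_real (- c2)) d2) (theta_seq (of_real a2) d2) (phiO d2 (of_real (- c2)) (of_real a2) (of_real (- b2)))
    (kapO d2 (of_real (- c2)) (of_real a2) (of_real (- b2))) (kapO d2 (of_real a2) (of_real (- b2)) (of_real (- c2)))
    (kapO d2 (of_real (- b2)) (of_real (- c2)) (of_real a2)) (\<lambda>i. - theta_seq (- of_real (- c2)) d2 i)
    (\<lambda>i. - phiO d2 (- of_real (- c2)) (of_real a2) (- of_real (- b2)) i)"
    using k_nonneg assms(7) unfolding par2 K_def k3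
    by (intro bi_pair_O_real[OF d2(1)] conjI notI) (simp_all add: d2(2) field_simps)
  show "bimod_irreducible W1"
    unfolding W1 by (rule bi_pair.irreducible_twist[OF E1]) simp_all
  show "bimod_irreducible W2"
    unfolding W2 by (rule bi_pair.irreducible_twist[OF O1]) simp_all
  \<comment> \<open>The twist lemmas produce the parameters \<open>(- c, a, - b)\<close>; their
    values are those of the second form.\<close>
  have neg1: "- complex_of_real c1 = of_real (k2 + (real n + 1) / 2)" "- complex_of_real b1 = of_real (K + (real n + 1) / 2)"
    by (simp_all add: par1)
  have "bimod_iso (bm_twist (-1, 1) cyc132 (E_mod d1 (of_real a1) (of_real b1) (of_real c1)))
      (bm_twist (-1, -1) id (E_mod d1 (- of_real c1) (of_real a1) (- of_real b1)))"
    using k_nonneg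
    by (intro E_twist_iso[OF E1 E2[unfolded of_real_minus] d1(1)] theta_seq_real_separated) (simp_all add: par1)
  from this[unfolded neg1] show "bimod_iso W1 (bm_twist (-1, -1) id
              (E_mod (n - t3) (of_real (k2 + (real n + 1) / 2)) (of_real (k1 + (real n + 1) / 2))
                              (of_real (K + (real n + 1) / 2))))"
    unfolding W1_def par1 d1_def .
  have neg2: "- complex_of_real c2 = of_real k2" "- complex_of_real b2 = of_real (K + real n + 1)"
    by (simp_all add: par2)
  have "bimod_iso (bm_twist (1, -1) cyc132 (O_mod d2 (of_real a2) (of_real b2) (of_real c2)))
      (O_mod d2 (- of_real c2) (of_real a2) (- of_real b2))"
    using k_nonneg
    by (intro O_twist_iso[OF O1 O2[unfolded of_real_minus] d2(1)] theta_seq_real_separated) (simp_all add: par2)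
  from this[unfolded neg2] show "bimod_iso W2 (O_mod (t3 - 1) (of_real k2) (of_real k1) (of_real (K + real n + 1)))"
    unfolding W2_def par2 d2_def .
qed

end
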